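(* Let $A$ be a unital $C^{*}$-algebra, and let $\phi_A$ and $d$ be as defined in the context. Then: (1) The image of $\phi_A$ is a subset of the unit sphere $S_A$ of $A$, and $d\in\{0,1\}$. Moreover, $d=1$ if and only if there is no nontrivial projection $a\in A$. (2) Closedness of the image of $\phi_A$ is a hereditary invariant: if the image of $\phi_A$ is a closed subset of $A$ and $B$ is a hereditary $C^{*}$-subalgebra of $A$, then the image of $\phi_B$ is a closed subset of $B$. (3) If the image of $\phi_A$ is a finite set, then it is equal to $\{1\}$ and $A$ is isomorphic to $\mathbb{C}^{2}$ or $M_{2}(\mathbb{C})$. (4) The image of $\phi_A$ is a compact set if and only if $A$ is a finite dimensional $C^{*}$-algebra.
   Context: For a $C^{*}$-algebra $A$, write $a>0$ if $a$ is positive and nonzero. The addition map $\phi_A$ is defined on the set $\{(a,b)\in A\times A : a>0,\ b>0,\ \|a\|=\|b\|=1,\ ab=0\}$ by $\phi_A(a,b)=a+b$. For unital $A$ with unit $1$, put $$d=\inf\{\|a+b-1\| : a,b\in A,\ ab=0,\ \|a\|=\|b\|=1,\ a>0,\ b>0\}.$$ The unit sphere is $S_A=\{x\in A:\|x\|=1\}$. A projection is an element $p$ with $p=p^{*}=p^{2}$; it is nontrivial if $p\ne 0,1$. A $C^{*}$-subalgebra $B$ of $A$ is hereditary if for every positive $b\in B$ and every $a\in A$ with $0\le a\le b$ we have $a\in B$. The map $\phi_B$ is defined for $B$ by the same formula as $\phi_A$, with $B$ in place of $A$.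
   Formalization: A is assumed nonzero, and the claims about d in (1) and all of (3) are stated only for A not equal to the scalars C: for A = C no admissible pairs exist, so d is an infimum over the empty set and the image is empty, hence finite but not {1}. *)

theory Defs
  imports "HOL-Analysis.Analysis"
begin

text \<open>
  The class \<open>real_normed_algebra_1\<close> requires \<open>norm 1 = 1\<close>, so a unital C*-algebra is
  nonzero here.
\<close>

class unital_cstar_algebra = real_normed_algebra_1 + banach +
  fixes scaleC :: "complex \<Rightarrow> 'a \<Rightarrow> 'a"  (infixr \<open>*\<^sub>C\<close> 75)
    and star :: "'a \<Rightarrow> 'a"
  assumes scaleC_add_right: "c *\<^sub>C (x + y) = c *\<^sub>C x + c *\<^sub>C y"
    and scaleC_add_left: "(c + d) *\<^sub>C x = c *\<^sub>C x + d *\<^sub>C x"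
    and scaleC_scaleC: "c *\<^sub>C d *\<^sub>C x = (c * d) *\<^sub>C x"
    and scaleR_scaleC: "scaleR r x = complex_of_real r *\<^sub>C x"
    and mult_scaleC_left: "(c *\<^sub>C x) * y = c *\<^sub>C (x * y)"
    and mult_scaleC_right: "x * (c *\<^sub>C y) = c *\<^sub>C (x * y)"
    and norm_scaleC: "norm (c *\<^sub>C x) = cmod c * norm x"
    and star_add: "star (x + y) = star x + star y"
    and star_scaleC: "star (c *\<^sub>C x) = cnj c *\<^sub>C star x"
    and star_mult: "star (x * y) = star y * star x"
    and star_star: "star (star x) = x"
    and cstar_identity: "norm (star x * x) = (norm x)\<^sup>2"

lemma vector_space_scaleC: "vector_space ((*\<^sub>C) :: complex \<Rightarrow> 'a::unital_cstar_algebra \<Rightarrow> 'a)"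
proof
  show "1 *\<^sub>C x = x" for x :: 'a
    by (metis of_real_1 scaleR_one scaleR_scaleC)
qed (simp_all add: scaleC_add_right scaleC_add_left scaleC_scaleC)

definition cstar_subalgebra :: "'a::unital_cstar_algebra set \<Rightarrow> bool" where
  "cstar_subalgebra B \<longleftrightarrow>
     0 \<in> B \<and> (\<forall>x\<in>B. \<forall>y\<in>B. x + y \<in> B) \<and> (\<forall>c. \<forall>x\<in>B. c *\<^sub>C x \<in> B) \<and>
     (\<forall>x\<in>B. \<forall>y\<in>B. x * y \<in> B) \<and> (\<forall>x\<in>B. star x \<in> B) \<and> closed B"

text \<open>
  Positivity inside a (possibly non-unital) C*-subalgebra \<open>B\<close>; the ambient algebra is
  \<open>B = UNIV\<close>.
\<close>

definition positive_in :: "'a::unital_cstar_algebra set \<Rightarrow> 'a \<Rightarrow> bool" where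
  "positive_in B a \<longleftrightarrow> (\<exists>x\<in>B. a = star x * x)"

definition cstar_le :: "'a::unital_cstar_algebra \<Rightarrow> 'a \<Rightarrow> bool" where
  "cstar_le a b \<longleftrightarrow> positive_in UNIV (b - a)"

definition hereditary :: "'a::unital_cstar_algebra set \<Rightarrow> bool" where
  "hereditary B \<longleftrightarrow>
     (\<forall>b\<in>B. cstar_le 0 b \<longrightarrow> (\<forall>a. cstar_le 0 a \<and> cstar_le a b \<longrightarrow> a \<in> B))"

definition add_dom :: "'a::unital_cstar_algebra set \<Rightarrow> ('a \<times> 'a) set" where
  "add_dom B = {(a, b). a \<in> B \<and> b \<in> B \<and> positive_in B a \<and> a \<noteq> 0 \<and> positive_in B b \<and> b \<noteq> 0 \<and>
                  norm a = 1 \<and> norm b = 1 \<and> a * b = 0}"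

definition add_map :: "'a::unital_cstar_algebra \<times> 'a \<Rightarrow> 'a" where
  "add_map = (\<lambda>(a, b). a + b)"

text \<open>
  The infimum is taken in the reals, so it is unspecified when there are no such pairs,
  which happens only for the algebra of complex scalars.
\<close>

definition unit_dist :: "'a::unital_cstar_algebra itself \<Rightarrow> real" where
  "unit_dist _ = (INF (a, b) \<in> add_dom (UNIV :: 'a set). norm (a + b - 1))"

definition only_scalars :: "'a::unital_cstar_algebra itself \<Rightarrow> bool" where
  "only_scalars _ \<longleftrightarrow> (\<forall>x::'a. \<exists>c. x = c *\<^sub>C 1)"

definition projection :: "'a::unital_cstar_algebra \<Rightarrow> bool" where
  "projection p \<longleftrightarrow> star p = p \<and> p * p = p"

definition nontrivial_projection :: "'a::unital_cstar_algebra \<Rightarrow> bool" where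
  "nontrivial_projection p \<longleftrightarrow> projection p \<and> p \<noteq> 0 \<and> p \<noteq> 1"

definition finite_dimensional :: "'a::unital_cstar_algebra itself \<Rightarrow> bool" where
  "finite_dimensional _ \<longleftrightarrow>
     (\<exists>S :: 'a set. finite S \<and> module.span (*\<^sub>C) S = UNIV)"

text \<open>
  The scalar multiplication, product and involution of the target are parameters, because the
  library's product on \<open>complex^2^2\<close> is the entrywise one. A bijective *-homomorphism is
  automatically unital and isometric for the C*-norms.
\<close>

definition star_isomorphism ::
  "(complex \<Rightarrow> 'b \<Rightarrow> 'b) \<Rightarrow> ('b \<Rightarrow> 'b \<Rightarrow> 'b) \<Rightarrow> ('b \<Rightarrow> 'b) \<Rightarrow>
   ('a::unital_cstar_algebra \<Rightarrow> 'b::ab_group_add) \<Rightarrow> bool" where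
  "star_isomorphism sc times' star' f \<longleftrightarrow>
     bij f \<and> (\<forall>x y. f (x + y) = f x + f y) \<and> (\<forall>c x. f (c *\<^sub>C x) = sc c (f x)) \<and>
     (\<forall>x y. f (x * y) = times' (f x) (f y)) \<and> (\<forall>x. f (star x) = star' (f x))"

definition isomorphic_C2 :: "'a::unital_cstar_algebra itself \<Rightarrow> bool" where
  "isomorphic_C2 _ \<longleftrightarrow>
     (\<exists>f :: 'a \<Rightarrow> complex^2. star_isomorphism (*s) (*) (\<lambda>v. \<chi> i. cnj (v $ i)) f)"

definition isomorphic_M2 :: "'a::unital_cstar_algebra itself \<Rightarrow> bool" where
  "isomorphic_M2 _ \<longleftrightarrow>
     (\<exists>f :: 'a \<Rightarrow> complex^2^2.
        star_isomorphism (\<lambda>c. map_matrix ((*) c)) (**) (\<lambda>M. transpose (map_matrix cnj M)) f)"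

end

theory Submission
  imports Defs "HOL-Computational_Algebra.Fundamental_Theorem_Algebra"
begin

text \<open>
  A continuous functional calculus for a self-adjoint element \<open>h\<close> is obtained from square roots and
  the equality of \<open>\<parallel>p(h)\<parallel>\<close> with the maximum of \<open>\<bar>p\<bar>\<close> over the spectrum, for real polynomials \<open>p\<close>. With
  it, every finite subset of the spectrum gives as many pairwise orthogonal positive elements.
  Finiteness or compactness of the image bounds the size of such orthogonal families. Under such a
  bound all spectra are finite, and a largest family of orthogonal projections with sum \<open>1\<close> consists
  of projections \<open>p\<close> with \<open>pAp = \<complex>p\<close>; then every \<open>pAq\<close> is at most one-dimensional, and \<open>A\<close> is the sum of
  these corners. For a hereditary \<open>B\<close>, the image of \<open>\<phi>\<^sub>B\<close> is the intersection of \<open>B\<close> with that of \<open>\<phi>\<^sub>A\<close>.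
  A pair whose sum is at distance \<open>< 1\<close> from the unit has an invertible sum, which gives a projection.
\<close>

section \<open>The involution and invertibility\<close>

text \<open>Two obstacles shape the proof. The norm of a self-adjoint \<open>h\<close> has to be
  read off its spectrum without characters or a spectral radius formula. The C*-identity lets square
  roots control norms, so that \<open>norm h ^ 2 - h * h\<close> is never invertible; factoring
  polynomials over the complex numbers carries this over to spectral points. Secondly,
  \<open>star x * x\<close> must have nonnegative spectrum. This is Kaplansky's argument with the
  negative part, and it lets positivity be tested on the spectrum.

  The scalars are exceptional: they contain no orthogonal pair, so the image is empty and
  \<open>d\<close> is an infimum over the empty set. The claims on \<open>d\<close> and on finite
  images exclude that algebra; those on hereditary subalgebras and compactness include it. In every
  other algebra some self-adjoint element has two spectral points, which gives a pair. The sum of a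
  pair is positive of norm 1, hence at distance at most 1 from the unit; with the projection found
  at distance below 1, only the values 0 and 1 remain for \<open>d\<close>.\<close>

interpretation cvs: vector_space "(*\<^sub>C) :: complex \<Rightarrow> 'a \<Rightarrow> 'a::unital_cstar_algebra"
  by (rule vector_space_scaleC)

definition self_adjoint :: "'a::unital_cstar_algebra \<Rightarrow> bool" where
  "self_adjoint x \<longleftrightarrow> star x = x"

definition alg_invertible :: "'a::ring_1 \<Rightarrow> bool" where
  "alg_invertible x \<longleftrightarrow> (\<exists>y. x * y = 1 \<and> y * x = 1)"

lemma star_0 [simp]: "star (0::'a::unital_cstar_algebra) = 0"
  using star_add[of "0::'a" 0] by simp

lemma star_minus [simp]: "star (- x) = - star (x::'a::unital_cstar_algebra)"
  using star_add[of x "- x"] by (simp add: eq_neg_iff_add_eq_0 add.commute)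

lemma star_diff: "star (x - y) = star x - star (y::'a::unital_cstar_algebra)"
  using star_add[of x "- y"] by simp

lemma star_1 [simp]: "star (1::'a::unital_cstar_algebra) = 1"
  by (metis mult.right_neutral star_mult star_star)

lemma star_scaleR: "star (r *\<^sub>R x) = r *\<^sub>R star (x::'a::unital_cstar_algebra)"
  by (simp add: scaleR_scaleC star_scaleC)

lemma star_power: "star (x ^ n) = star (x::'a::unital_cstar_algebra) ^ n"
  by (induction n) (simp_all add: star_mult power_commutes)

lemma norm_star [simp]: "norm (star x) = norm (x::'a::unital_cstar_algebra)"
proof -
  have *: "norm y \<le> norm (star y)" for y :: 'a
  proof (cases "y = 0")
    case False
    have "norm y * norm y \<le> norm (star y) * norm y"
      using cstar_identity[of y] norm_mult_ineq[of "star y" y] by (simp add: power2_eq_square)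
    then show ?thesis using False by simp
  qed simp
  show ?thesis using *[of x] *[of "star x"] by (simp add: star_star)
qed

lemma tendsto_star [tendsto_intros]:
  assumes "(f \<longlongrightarrow> (l::'a::unital_cstar_algebra)) F"
  shows "((\<lambda>x. star (f x)) \<longlongrightarrow> star l) F"
proof -
  have "((\<lambda>x. norm (f x - l)) \<longlongrightarrow> 0) F" using assms by (simp add: LIM_zero tendsto_norm_zero)
  then have "((\<lambda>x. norm (star (f x) - star l)) \<longlongrightarrow> 0) F" by (simp flip: star_diff)
  then show ?thesis using LIM_zero_cancel tendsto_norm_zero_iff by blast
qed

lemma self_adjoint_0 [simp]: "self_adjoint 0"
  and self_adjoint_1 [simp]: "self_adjoint 1"
  by (simp_all add: self_adjoint_def)

lemma self_adjoint_add: "self_adjoint x \<Longrightarrow> self_adjoint y \<Longrightarrow> self_adjoint (x + y)"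
  and self_adjoint_diff: "self_adjoint x \<Longrightarrow> self_adjoint y \<Longrightarrow> self_adjoint (x - y)"
  and self_adjoint_scaleR: "self_adjoint x \<Longrightarrow> self_adjoint (r *\<^sub>R x)"
  and self_adjoint_mult: "self_adjoint x \<Longrightarrow> self_adjoint y \<Longrightarrow> x * y = y * x \<Longrightarrow> self_adjoint (x * y)"
  and self_adjoint_power: "self_adjoint x \<Longrightarrow> self_adjoint (x ^ n)"
  and self_adjoint_star_mult: "self_adjoint (star z * z)"
  by (simp_all add: self_adjoint_def star_add star_diff star_scaleR star_mult star_power star_star)

lemma self_adjoint_lim:
  assumes "\<And>n. self_adjoint (f n)" "f \<longlonglongrightarrow> l"
  shows "self_adjoint l"
proof -
  have "(\<lambda>n. star (f n)) = f" using assms(1) by (simp add: self_adjoint_def)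
  with tendsto_star[OF assms(2)] assms(2) show ?thesis
    unfolding self_adjoint_def by (simp add: LIMSEQ_unique)
qed

lemma norm_square_self_adjoint: "self_adjoint x \<Longrightarrow> norm (x * x) = norm x * norm x"
  using cstar_identity[of x] by (simp add: self_adjoint_def power2_eq_square)

lemma scaleC_of_real: "complex_of_real r *\<^sub>C x = r *\<^sub>R x"
  by (simp add: scaleR_scaleC)

lemma cartesian_decomposition:
  fixes x :: "'a::unital_cstar_algebra"
  obtains h k where "self_adjoint h" "self_adjoint k" "x = h + \<i> *\<^sub>C k"
proof
  define h where "h = (1/2) *\<^sub>R (x + star x)"
  define k where "k = (- \<i> / 2) *\<^sub>C (x - star x)"
  show "self_adjoint h"
    by (simp add: h_def self_adjoint_def star_scaleR star_add star_star add.commute)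
  have "star k = (\<i> / 2) *\<^sub>C (star x - x)"
    by (simp add: k_def star_scaleC star_diff star_star)
  also have "\<dots> = k"
    by (simp add: k_def cvs.scale_right_diff_distrib)
  finally show "self_adjoint k" by (simp add: self_adjoint_def)
  have "\<i> *\<^sub>C k = (1/2) *\<^sub>C (x - star x)"
    by (simp add: k_def scaleC_scaleC)
  also have "\<dots> = (1/2) *\<^sub>R (x - star x)"
    using scaleC_of_real[of "1/2" "x - star x"] by simp
  finally show "x = h + \<i> *\<^sub>C k"
    by (simp add: h_def scaleR_right_diff_distrib scaleR_add_right flip: scaleR_left.add)
qed

lemma star_add_i_mult:
  fixes h k :: "'a::unital_cstar_algebra"
  assumes "self_adjoint h" "self_adjoint k"
  shows "star (h + \<i> *\<^sub>C k) = h - \<i> *\<^sub>C k"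
  using assms by (simp add: self_adjoint_def star_add star_scaleC cvs.scale_minus_left)

lemma mult_add_diff_i:
  fixes h k :: "'a::unital_cstar_algebra"
  assumes "h * k = k * h"
  shows "(h - \<i> *\<^sub>C k) * (h + \<i> *\<^sub>C k) = h * h + k * k"
    and "(h + \<i> *\<^sub>C k) * (h - \<i> *\<^sub>C k) = h * h + k * k"
  by (simp_all add: algebra_simps mult_scaleC_left mult_scaleC_right scaleC_scaleC assms)

text \<open>For noncommuting \<open>h\<close> and \<open>k\<close> the cross terms
  \<open>i (h k - k h)\<close> cancel only in this symmetric sum. It expresses
  \<open>star y * y + y * star y\<close> through squares of self-adjoint elements.\<close>

lemma mult_add_diff_i_sum:
  fixes h k :: "'a::unital_cstar_algebra"
  shows "(h - \<i> *\<^sub>C k) * (h + \<i> *\<^sub>C k) + (h + \<i> *\<^sub>C k) * (h - \<i> *\<^sub>C k) = 2 *\<^sub>R (h * h + k * k)"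
  by (simp add: algebra_simps mult_scaleC_left mult_scaleC_right scaleC_scaleC scaleR_2)

section \<open>Invertible elements and the Neumann series\<close>

lemma alg_invertible_1 [simp]: "alg_invertible 1"
  unfolding alg_invertible_def by (metis mult_1_left)

lemma alg_invertible_mult:
  assumes "alg_invertible x" "alg_invertible y" shows "alg_invertible (x * y)"
proof -
  from assms obtain a b where "x * a = 1" "a * x = 1" "y * b = 1" "b * y = 1"
    unfolding alg_invertible_def by blast
  then have "(x * y) * (b * a) = 1" "(b * a) * (x * y) = 1"
    by (metis mult.assoc mult_1_left)+
  then show ?thesis unfolding alg_invertible_def by blast
qed

text \<open>Commutation gives each factor a left and a right inverse, and these two
  coincide.\<close>

lemma alg_invertible_factors:
  assumes "alg_invertible (x * y)" "x * y = y * x"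
  shows "alg_invertible x" "alg_invertible y"
proof -
  from assms obtain z where z: "x * y * z = 1" "z * (x * y) = 1"
    unfolding alg_invertible_def by blast
  have "x * (y * z) = 1" "(z * y) * x = 1" using z assms(2) by (metis mult.assoc)+
  then show "alg_invertible x" unfolding alg_invertible_def by (metis mult.assoc mult.right_neutral mult_1_left)
  have "y * (x * z) = 1" "(z * x) * y = 1" using z assms(2) by (metis mult.assoc)+
  then show "alg_invertible y" unfolding alg_invertible_def by (metis mult.assoc mult.right_neutral mult_1_left)
qed

lemma alg_invertible_scaleC:
  fixes x :: "'a::unital_cstar_algebra"
  assumes "alg_invertible x" "c \<noteq> 0" shows "alg_invertible (c *\<^sub>C x)"
proof -
  from assms obtain y where y: "x * y = 1" "y * x = 1"
    unfolding alg_invertible_def by blast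
  then have "(c *\<^sub>C x) * (inverse c *\<^sub>C y) = 1" "(inverse c *\<^sub>C y) * (c *\<^sub>C x) = 1"
    using assms(2) by (simp_all add: mult_scaleC_left mult_scaleC_right scaleC_scaleC)
  then show ?thesis unfolding alg_invertible_def by blast
qed

lemma alg_invertible_scaleR:
  fixes x :: "'a::unital_cstar_algebra"
  assumes "alg_invertible x" "c \<noteq> 0" shows "alg_invertible (c *\<^sub>R x)"
  using alg_invertible_scaleC[OF assms(1), of "complex_of_real c"] assms(2)
  by (simp add: scaleR_scaleC)

lemma alg_invertible_minus: "alg_invertible x \<Longrightarrow> alg_invertible (- x)"
  unfolding alg_invertible_def by (metis minus_mult_minus)

lemma alg_invertible_zero_divisor:
  assumes "alg_invertible x" "x * y = 0" shows "y = 0"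
  using assms unfolding alg_invertible_def by (metis mult.assoc mult_1_left mult_zero_right)

lemma neumann_invertible:
  fixes x :: "'a::unital_cstar_algebra"
  assumes "norm x < 1"
  shows "alg_invertible (1 - x)"
proof -
  have s: "summable (\<lambda>n. x ^ n)"
    using assms by (rule complete_algebra_summable_geometric)
  have e: "(\<Sum>n. x ^ n) = 1 + (\<Sum>n. x ^ Suc n)"
    using suminf_split_head[OF s] by (simp add: algebra_simps)
  have "(\<Sum>n. x ^ Suc n) = x * (\<Sum>n. x ^ n)"
    using suminf_mult[OF s, of x] by simp
  moreover have "(\<Sum>n. x ^ Suc n) = (\<Sum>n. x ^ n) * x"
    using suminf_mult2[OF s, of x] by (simp add: power_commutes)
  ultimately have "(1 - x) * (\<Sum>n. x ^ n) = 1" "(\<Sum>n. x ^ n) * (1 - x) = 1"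
    using e by (simp_all add: algebra_simps)
  then show ?thesis unfolding alg_invertible_def by blast
qed

lemma neumann_invertible_scaled:
  fixes x :: "'a::unital_cstar_algebra"
  assumes "norm x < \<bar>r\<bar>"
  shows "alg_invertible (x - r *\<^sub>R 1)"
proof -
  have r: "r \<noteq> 0" using assms norm_ge_zero[of x] by auto
  have "norm ((1 / r) *\<^sub>R x) < 1"
    using assms r by (simp add: divide_simps)
  from alg_invertible_scaleR[OF neumann_invertible[OF this], of "- r"] r
  show ?thesis by (simp add: scaleR_right_diff_distrib)
qed

section \<open>Square roots\<close>

text \<open>
  The iteration \<open>y \<mapsto> (k + y\<^sup>2) / 2\<close> produces polynomials in \<open>k\<close> with nonnegative coefficients, so its
  increments are dominated by those of the scalar iteration for \<open>k = 1\<close>; the limit satisfies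
  \<open>(1 - y)\<^sup>2 = 1 - k\<close>.
\<close>

fun sqrt_iter :: "'a::real_algebra_1 \<Rightarrow> nat \<Rightarrow> 'a" where
  "sqrt_iter k 0 = 0"
| "sqrt_iter k (Suc n) = (1/2) *\<^sub>R (k + sqrt_iter k n * sqrt_iter k n)"

lemma sqrt_iter_commute: "x * k = k * x \<Longrightarrow> x * sqrt_iter k n = sqrt_iter k n * x"
  by (induction n) (simp_all add: algebra_simps, metis mult.assoc)

lemma sqrt_iter_commute': "sqrt_iter k m * sqrt_iter k n = sqrt_iter k n * sqrt_iter k m"
  by (metis sqrt_iter_commute)

lemma sqrt_iter_self_adjoint: "self_adjoint k \<Longrightarrow> self_adjoint (sqrt_iter k n)"
  by (induction n) (auto intro!: self_adjoint_scaleR self_adjoint_add self_adjoint_mult)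

lemma sqrt_iter_real: "0 \<le> sqrt_iter (1::real) n \<and> sqrt_iter (1::real) n \<le> 1"
proof (induction n)
  case (Suc n)
  then have "sqrt_iter (1::real) n * sqrt_iter 1 n \<le> 1 * 1" by (intro mult_mono) auto
  then show ?case using Suc by simp
qed simp

lemma norm_sqrt_iter:
  fixes k :: "'a::real_normed_algebra_1"
  assumes "norm k \<le> 1"
  shows "norm (sqrt_iter k n) \<le> sqrt_iter 1 n"
proof (induction n)
  case (Suc n)
  have "norm (sqrt_iter k n * sqrt_iter k n) \<le> sqrt_iter 1 n * sqrt_iter 1 n"
    by (rule order_trans[OF norm_mult_ineq]) (use Suc sqrt_iter_real[of n] in \<open>auto intro!: mult_mono\<close>)
  then have "norm (k + sqrt_iter k n * sqrt_iter k n) \<le> 1 + sqrt_iter 1 n * sqrt_iter 1 n"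
    using norm_triangle_ineq[of k "sqrt_iter k n * sqrt_iter k n"] assms by linarith
  then show ?case by simp
qed simp

text \<open>The iterates commute, so the difference of two squares factors, and each factor is
  dominated by its scalar counterpart.\<close>

lemma norm_sqrt_iter_increment:
  fixes k :: "'a::real_normed_algebra_1"
  assumes "norm k \<le> 1"
  shows "norm (sqrt_iter k (Suc n) - sqrt_iter k n) \<le> sqrt_iter 1 (Suc n) - sqrt_iter 1 n"
proof (induction n)
  case 0
  then show ?case using assms by simp
next
  case (Suc n)
  define a b where "a = sqrt_iter k n" and "b = sqrt_iter k (Suc n)"
  define u v where "u = sqrt_iter (1::real) n" and "v = sqrt_iter (1::real) (Suc n)"
  have ab: "a * b = b * a" unfolding a_def b_def by (rule sqrt_iter_commute')
  have "sqrt_iter k (Suc (Suc n)) - sqrt_iter k (Suc n) = (1/2) *\<^sub>R (b * b - a * a)"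
    unfolding a_def b_def sqrt_iter.simps(2)[of k "Suc n"] sqrt_iter.simps(2)[of k n]
    by (simp only: scaleR_right_diff_distrib scaleR_right_distrib) simp
  also have "b * b - a * a = (b - a) * (b + a)" using ab by (simp add: algebra_simps)
  finally have "norm (sqrt_iter k (Suc (Suc n)) - sqrt_iter k (Suc n)) = (1/2) * norm ((b - a) * (b + a))"
    by simp
  also have "norm ((b - a) * (b + a)) \<le> (v - u) * (v + u)"
  proof (rule order_trans[OF norm_mult_ineq], rule mult_mono)
    show "norm (b - a) \<le> v - u" using Suc by (simp add: a_def b_def u_def v_def)
    show "norm (b + a) \<le> v + u"
      using norm_triangle_ineq[of b a] norm_sqrt_iter[OF assms, of n] norm_sqrt_iter[OF assms, of "Suc n"]
      unfolding a_def b_def u_def v_def by linarith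
    show "0 \<le> v - u" using order_trans[OF norm_ge_zero Suc] unfolding u_def v_def .
  qed simp
  also have "(1/2) * ((v - u) * (v + u)) = sqrt_iter 1 (Suc (Suc n)) - sqrt_iter 1 (Suc n)"
    unfolding u_def v_def by (simp add: field_simps)
  finally show ?case by simp
qed

lemma sqrt_iter_convergent:
  fixes k :: "'a::unital_cstar_algebra"
  assumes "norm k \<le> 1"
  shows "convergent (sqrt_iter k)"
proof -
  let ?r = "sqrt_iter (1::real)"
  \<comment> \<open>Each scalar increment dominates a norm, so it is nonnegative.\<close>
  have mono: "?r n \<le> ?r (Suc n)" for n
    using order_trans[OF norm_ge_zero norm_sqrt_iter_increment[OF assms, of n]] by linarith
  have "convergent ?r"
    using sqrt_iter_real mono by (intro Bseq_mono_convergent BseqI'[of _ 1]) (auto simp: incseq_SucI incseqD)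
  then have "summable (\<lambda>n. ?r (Suc n) - ?r n)"
    by (metis convergent_def telescope_summable)
  then have "summable (\<lambda>n. sqrt_iter k (Suc n) - sqrt_iter k n)"
    by (rule summable_comparison_test[rotated]) (use norm_sqrt_iter_increment[OF assms] in blast)
  then have "convergent (\<lambda>n. \<Sum>i<n. sqrt_iter k (Suc i) - sqrt_iter k i)"
    by (simp add: summable_iff_convergent)
  then show ?thesis by (simp only: sum_lessThan_telescope) simp
qed

text \<open>The bound allows \<open>norm k = 1\<close>, where \<open>1 - k\<close> may fail to be
  invertible. Commutation with everything that commutes with \<open>k\<close> makes products of such
  roots manageable before a functional calculus is available.\<close>

lemma square_root_exists:
  fixes k :: "'a::unital_cstar_algebra"
  assumes "norm k \<le> 1" "self_adjoint k"
  obtains v where "self_adjoint v" "v * v = 1 - k" "\<And>x. x * k = k * x \<Longrightarrow> x * v = v * x"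
proof -
  from sqrt_iter_convergent[OF assms(1)] obtain y where y: "sqrt_iter k \<longlonglongrightarrow> y"
    by (auto simp: convergent_def)
  have "(\<lambda>n. sqrt_iter k (Suc n)) \<longlonglongrightarrow> (1/2) *\<^sub>R (k + y * y)"
    unfolding sqrt_iter.simps by (intro tendsto_intros y)
  with LIMSEQ_Suc[OF y] have "y = (1/2) *\<^sub>R (k + y * y)" by (rule LIMSEQ_unique)
  then have "2 *\<^sub>R y = 2 *\<^sub>R (1/2) *\<^sub>R (k + y * y)" by (rule arg_cong)
  then have "2 *\<^sub>R y = k + y * y" by simp
  then have "(1 - y) * (1 - y) = 1 - k" by (simp add: algebra_simps scaleR_2)
  moreover have "self_adjoint (1 - y)"
    using self_adjoint_lim[OF sqrt_iter_self_adjoint[OF assms(2)] y] by (simp add: self_adjoint_diff)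
  moreover have "x * (1 - y) = (1 - y) * x" if "x * k = k * x" for x
  proof -
    have "(\<lambda>n. x * sqrt_iter k n) \<longlonglongrightarrow> x * y" "(\<lambda>n. sqrt_iter k n * x) \<longlonglongrightarrow> y * x"
      by (intro tendsto_intros y)+
    then have "x * y = y * x" using sqrt_iter_commute[OF that] LIMSEQ_unique by simp
    then show ?thesis by (simp add: algebra_simps)
  qed
  ultimately show thesis using that by blast
qed

text \<open>For \<open>u = h + i w\<close> the C*-identity gives \<open>norm u ^ 2 = r\<close>, and
  \<open>h\<close>, \<open>w\<close> are the real and imaginary parts of \<open>u\<close>.\<close>

lemma norm_le_of_squares:
  fixes h w :: "'a::unital_cstar_algebra"
  assumes "self_adjoint h" "self_adjoint w" "h * w = w * h" "h * h + w * w = r *\<^sub>R 1" "r \<ge> 0"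
  shows "norm h ^ 2 \<le> r" "norm w ^ 2 \<le> r"
proof -
  let ?u = "h + \<i> *\<^sub>C w" and ?v = "h - \<i> *\<^sub>C w"
  have "star ?u = ?v" by (rule star_add_i_mult[OF assms(1,2)])
  then have "norm (r *\<^sub>R (1::'a)) = norm ?u ^ 2"
    using cstar_identity[of ?u] mult_add_diff_i(1)[OF assms(3)] assms(4) by metis
  moreover have "norm ?v = norm ?u" using \<open>star ?u = ?v\<close> norm_star by metis
  ultimately have u: "\<bar>r\<bar> = norm ?u ^ 2" "norm ?v = norm ?u" by simp_all
  have "2 *\<^sub>R h = ?u + ?v" by (simp add: scaleR_2)
  then have "2 * norm h \<le> 2 * norm ?u" using norm_triangle_ineq[of ?u ?v] u(2)
    by (metis norm_scaleR abs_numeral mult_2)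
  moreover have "2 * norm w \<le> 2 * norm ?u"
  proof -
    have "2 *\<^sub>R \<i> *\<^sub>C w = ?u - ?v" by (simp add: scaleR_2)
    then have "norm (2 *\<^sub>R \<i> *\<^sub>C w) \<le> norm ?u + norm ?v" using norm_triangle_ineq4[of ?u ?v] by metis
    then show ?thesis unfolding norm_scaleR norm_scaleC u(2) by simp
  qed
  ultimately have "norm h ^ 2 \<le> \<bar>r\<bar>" "norm w ^ 2 \<le> \<bar>r\<bar>"
    unfolding u(1) by (auto intro!: power_mono)
  with assms(5) show "norm h ^ 2 \<le> r" "norm w ^ 2 \<le> r" by simp_all
qed

section \<open>The spectrum of a self-adjoint element\<close>

text \<open>The triangle inequality yields only the bound 2. A root \<open>s\<close> of
  \<open>1 - h * h\<close> satisfies \<open>h * h + s * s = 1\<close>, which bounds \<open>s\<close>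
  by 1.\<close>

lemma norm_one_minus_square:
  fixes h :: "'a::unital_cstar_algebra"
  assumes "self_adjoint h" "norm h \<le> 1"
  shows "norm (1 - h * h) \<le> 1"
proof -
  have "norm (h * h) \<le> 1"
    using assms by (simp add: norm_square_self_adjoint mult_le_one)
  moreover have "self_adjoint (h * h)" using assms(1) by (simp add: self_adjoint_mult)
  ultimately obtain s where s: "self_adjoint s" "s * s = 1 - h * h"
    and c: "\<And>x. x * (h * h) = (h * h) * x \<Longrightarrow> x * s = s * x"
    using square_root_exists by blast
  have "h * s = s * h" by (rule c) (simp add: mult.assoc)
  from norm_le_of_squares(2)[OF assms(1) s(1) this, of 1] have "norm s ^ 2 \<le> 1"
    using s(2) by simp
  then show ?thesis using norm_square_self_adjoint[OF s(1)] s(2) by (simp add: power2_eq_square)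
qed

lemma norm_square_defect:
  fixes h :: "'a::unital_cstar_algebra"
  assumes "self_adjoint h"
  shows "norm ((norm h)\<^sup>2 *\<^sub>R 1 - h * h) \<le> (norm h)\<^sup>2"
proof (cases "h = 0")
  case False
  define g where "g = (1 / norm h) *\<^sub>R h"
  have h: "h * h = (norm h)\<^sup>2 *\<^sub>R (g * g)" using False by (simp add: g_def power2_eq_square)
  have "norm (1 - g * g) \<le> 1"
    by (rule norm_one_minus_square) (use assms False in \<open>simp_all add: g_def self_adjoint_scaleR\<close>)
  moreover have "(norm h)\<^sup>2 *\<^sub>R 1 - h * h = (norm h)\<^sup>2 *\<^sub>R (1 - g * g)"
    by (simp add: h scaleR_right_diff_distrib)
  ultimately show ?thesis by (simp add: mult_left_le)
qed simp

text \<open>With \<open>T = norm g ^ 2 + r\<close> the element is \<open>T - x\<close>, where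
  \<open>x = norm g ^ 2 - g * g\<close> has norm less than \<open>T\<close>. This is why squares
  have no negative spectrum.\<close>

lemma alg_invertible_square_plus:
  fixes g :: "'a::unital_cstar_algebra"
  assumes "self_adjoint g" "r > 0"
  shows "alg_invertible (g * g + r *\<^sub>R 1)"
proof -
  let ?x = "(norm g)\<^sup>2 *\<^sub>R 1 - g * g" and ?T = "(norm g)\<^sup>2 + r"
  have "norm ?x < \<bar>?T\<bar>" using norm_square_defect[OF assms(1)] assms(2) by simp
  from alg_invertible_minus[OF neumann_invertible_scaled[OF this]]
  show ?thesis by (simp add: scaleR_left_distrib add.commute)
qed

text \<open>The product of \<open>h - z\<close> with the commuting factor \<open>h - cnj z\<close>
  is a square plus the positive scalar \<open>(Im z)^2\<close>.\<close>

lemma alg_invertible_nonreal: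
  fixes h :: "'a::unital_cstar_algebra"
  assumes "self_adjoint h" "Im z \<noteq> 0"
  shows "alg_invertible (h - z *\<^sub>C 1)"
proof -
  define g where "g = h - Re z *\<^sub>R 1"
  define k where "k = Im z *\<^sub>R (1::'a)"
  have g: "self_adjoint g" unfolding g_def using assms(1)
    by (intro self_adjoint_diff self_adjoint_scaleR) auto
  have "z *\<^sub>C (1::'a) = complex_of_real (Re z) *\<^sub>C 1 + (\<i> * complex_of_real (Im z)) *\<^sub>C 1"
    by (metis complex_eq scaleC_add_left)
  then have z: "h - z *\<^sub>C 1 = g - \<i> *\<^sub>C k"
    unfolding g_def k_def scaleR_scaleC scaleC_scaleC by simp
  have gk: "g * k = k * g" by (simp add: k_def)
  have "alg_invertible (g * g + (Im z)\<^sup>2 *\<^sub>R 1)"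
    using alg_invertible_square_plus[OF g] assms(2) by simp
  also have "g * g + (Im z)\<^sup>2 *\<^sub>R 1 = (g - \<i> *\<^sub>C k) * (g + \<i> *\<^sub>C k)"
    unfolding mult_add_diff_i(1)[OF gk] by (simp add: k_def power2_eq_square)
  finally show ?thesis
    unfolding z by (rule alg_invertible_factors(1)) (simp add: mult_add_diff_i[OF gk])
qed

text \<open>
  If \<open>1 - h\<^sup>2\<close> had an inverse of norm less than \<open>M\<close>, then \<open>1 - h\<^sup>2 - 1/M\<close> would be a square \<open>w\<^sup>2\<close>, and
  \<open>h\<^sup>2 + w\<^sup>2 = 1 - 1/M\<close> would force \<open>\<parallel>h\<parallel> < 1\<close>.
\<close>

lemma not_invertible_one_minus_square:
  fixes h :: "'a::unital_cstar_algebra"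
  assumes h: "self_adjoint h" and norm: "norm h = 1"
  shows "\<not> alg_invertible (1 - h * h)"
proof
  assume "alg_invertible (1 - h * h)"
  then obtain r where r: "(1 - h * h) * r = 1" "r * (1 - h * h) = 1"
    unfolding alg_invertible_def by blast
  have hh: "self_adjoint (h * h)" using h by (simp add: self_adjoint_mult)
  have "norm (h * h) \<le> 1" using h norm by (simp add: norm_square_self_adjoint)
  then obtain s where s: "self_adjoint s" "s * s = 1 - h * h"
    and cs: "\<And>x. x * (h * h) = (h * h) * x \<Longrightarrow> x * s = s * x"
    using hh square_root_exists by blast
  have hs: "h * s = s * h" by (rule cs) (simp add: mult.assoc)
  have comm_r: "x * r = r * x" if "x * (1 - h * h) = (1 - h * h) * x" for x
  proof -
    have "x * r = r * ((1 - h * h) * x) * r" using r(2) by (simp flip: mult.assoc)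
    also have "\<dots> = r * x * ((1 - h * h) * r)" unfolding that[symmetric] by (simp only: mult.assoc)
    finally show ?thesis using r(1) by simp
  qed
  have "self_adjoint r"
  proof -
    have "star r * (1 - h * h) = 1"
      using arg_cong[OF r(1), of star] hh by (simp add: star_mult star_diff self_adjoint_def)
    then have "star r = r" using r(1) by (metis mult.assoc mult.right_neutral mult_1_left)
    then show ?thesis by (simp add: self_adjoint_def)
  qed
  \<comment> \<open>The summand 1 ensures \<open>M >= 1\<close>, so that \<open>1 - 1 / M\<close> is
    nonnegative.\<close>
  define M where "M = norm r + 1"
  have M: "M \<ge> 1" "norm r \<le> M" by (simp_all add: M_def)
  define q where "q = (1 / M) *\<^sub>R r"
  have "norm q \<le> 1" "self_adjoint q"
    using M \<open>self_adjoint r\<close> by (simp_all add: q_def self_adjoint_scaleR divide_simps)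
  then obtain v where v: "self_adjoint v" "v * v = 1 - q"
    and cv: "\<And>x. x * q = q * x \<Longrightarrow> x * v = v * x"
    using square_root_exists by blast
  have hv: "h * v = v * h"
    by (rule cv) (use comm_r[of h] in \<open>simp add: q_def algebra_simps\<close>)
  have sv: "s * v = v * s"
  proof (rule cv)
    have "s * (1 - h * h) = (1 - h * h) * s" unfolding s(2)[symmetric] by (simp add: mult.assoc)
    from comm_r[OF this] show "s * q = q * s" by (simp add: q_def)
  qed
  \<comment> \<open>\<open>w * w\<close> equals \<open>(1 - h * h) * (1 - r / M)\<close>, and
    \<open>r\<close> inverts the first factor, which leaves
    \<open>1 - h * h - 1 / M\<close>.\<close>
  define w where "w = s * v"
  have "w * w = (s * s) * (v * v)" unfolding w_def using sv by (metis mult.assoc)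
  also have "\<dots> = (1 - h * h) - (1 / M) *\<^sub>R ((1 - h * h) * r)"
    unfolding s(2) v(2) q_def by (simp only: right_diff_distrib mult_scaleR_right mult.right_neutral)
  finally have "h * h + w * w = (1 - 1 / M) *\<^sub>R 1"
    using r(1) by (simp add: scaleR_left_diff_distrib)
  moreover have "self_adjoint w" unfolding w_def by (rule self_adjoint_mult[OF s(1) v(1) sv])
  moreover have "h * w = w * h" unfolding w_def using hs hv by (metis mult.assoc)
  moreover have "0 \<le> 1 - 1 / M" using M(1) by simp
  ultimately have "norm h ^ 2 \<le> 1 - 1 / M" using norm_le_of_squares(1)[OF h] by blast
  then show False using norm M(1) by simp
qed

lemma not_invertible_norm_square:
  fixes h :: "'a::unital_cstar_algebra"
  assumes "self_adjoint h"
  shows "\<not> alg_invertible ((norm h)\<^sup>2 *\<^sub>R 1 - h * h)"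
proof (cases "h = 0")
  case True
  then show ?thesis by (simp add: alg_invertible_def)
next
  case False
  define g where "g = (1 / norm h) *\<^sub>R h"
  have h: "h * h = (norm h)\<^sup>2 *\<^sub>R (g * g)" using False by (simp add: g_def power2_eq_square)
  have n: "\<not> alg_invertible (1 - g * g)"
    by (rule not_invertible_one_minus_square)
      (use assms False in \<open>simp_all add: g_def self_adjoint_scaleR\<close>)
  have "(1 / (norm h)\<^sup>2) *\<^sub>R ((norm h)\<^sup>2 *\<^sub>R 1 - h * h) = 1 - g * g"
    using False by (simp add: h scaleR_right_diff_distrib)
  with n alg_invertible_scaleR[of "(norm h)\<^sup>2 *\<^sub>R 1 - h * h" "1 / (norm h)\<^sup>2"] False
  show ?thesis by auto
qed

text \<open>Only real points are recorded; for self-adjoint elements there are no others.\<close>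

definition spectrum :: "'a::unital_cstar_algebra \<Rightarrow> real set" where
  "spectrum h = {t. \<not> alg_invertible (h - t *\<^sub>R 1)}"

lemma spectrum_bound: "t \<in> spectrum h \<Longrightarrow> \<bar>t\<bar> \<le> norm h"
  using neumann_invertible_scaled[of h t] unfolding spectrum_def by force

section \<open>Polynomials in an element, and the norm as a maximum over the spectrum\<close>

definition peval :: "complex poly \<Rightarrow> 'a::unital_cstar_algebra \<Rightarrow> 'a" where
  "peval p x = fold_coeffs (\<lambda>c y. c *\<^sub>C 1 + x * y) p 0"

lemma peval_0 [simp]: "peval 0 x = 0"
  by (simp add: peval_def)

lemma peval_pCons [simp]: "peval (pCons c p) x = c *\<^sub>C 1 + x * peval p x"
  by (cases "c = 0 \<and> p = 0") (auto simp: peval_def)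

lemma peval_add: "peval (p + q) x = peval p x + peval q x"
  by (induction p q rule: poly_induct2) (simp_all add: scaleC_add_left algebra_simps)

lemma peval_smult: "peval (smult c p) x = c *\<^sub>C peval p x"
  by (induction p) (simp_all add: scaleC_add_right scaleC_scaleC mult_scaleC_right)

lemma peval_commute: "y * x = x * y \<Longrightarrow> y * peval p x = peval p x * y"
  by (induction p) (simp_all add: algebra_simps mult_scaleC_left mult_scaleC_right, metis mult.assoc)

lemma peval_mult: "peval (p * q) x = peval p x * peval q x"
  by (induction p) (simp_all add: peval_add peval_smult algebra_simps mult_scaleC_left mult.assoc)

text \<open>Linear factors are split off one at a time: a product that is not invertible has a
  factor that is not invertible.\<close>

lemma peval_root:
  fixes h :: "'a::unital_cstar_algebra"
  assumes "p \<noteq> 0" "\<not> alg_invertible (peval p h)"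
  shows "\<exists>z. poly p z = 0 \<and> \<not> alg_invertible (h - z *\<^sub>C 1)"
  using assms
proof (induction "degree p" arbitrary: p)
  case 0
  then obtain c where c: "p = [:c:]" "c \<noteq> 0"
    by (metis degree_0_id pCons_0_0 zero_neq_one)
  then have "alg_invertible (peval p h)" using alg_invertible_scaleC[OF alg_invertible_1] by simp
  with 0 show ?case by simp
next
  case (Suc n)
  then obtain z where z: "poly p z = 0" using alg_closed_imp_poly_has_root[of p] by auto
  then obtain q where q: "p = [:- z, 1:] * q" by (metis dvdE poly_eq_0_iff_dvd)
  then have "q \<noteq> 0" using Suc.prems by auto
  then have "degree q = n" using Suc.hyps(2) unfolding q by (subst (asm) degree_mult_eq) auto
  have e: "peval p h = (h - z *\<^sub>C 1) * peval q h"
    unfolding q peval_mult by (simp add: cvs.scale_minus_left)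
  show ?case
  proof (cases "alg_invertible (h - z *\<^sub>C 1)")
    case True
    then have "\<not> alg_invertible (peval q h)" using alg_invertible_mult Suc.prems(2) e by metis
    with Suc.hyps(1)[of q] \<open>degree q = n\<close> \<open>q \<noteq> 0\<close> show ?thesis using q by auto
  qed (use z in blast)
qed

text \<open>Complex coefficients make the splitting into linear factors available; real ones keep
  values at self-adjoint elements self-adjoint.\<close>

definition rpeval :: "real poly \<Rightarrow> 'a::unital_cstar_algebra \<Rightarrow> 'a" where
  "rpeval p x = peval (map_poly complex_of_real p) x"

lemma rpeval_0 [simp]: "rpeval 0 x = 0"
  by (simp add: rpeval_def)

lemma rpeval_pCons [simp]: "rpeval (pCons c p) x = c *\<^sub>R 1 + x * rpeval p x"
  by (simp add: rpeval_def map_poly_pCons scaleR_scaleC)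

lemma rpeval_add: "rpeval (p + q) x = rpeval p x + rpeval q x"
  by (induction p q rule: poly_induct2) (simp_all add: scaleR_left_distrib algebra_simps)

lemma rpeval_smult: "rpeval (smult c p) x = c *\<^sub>R rpeval p x"
  by (induction p) (simp_all add: scaleR_right_distrib)

lemma rpeval_mult: "rpeval (p * q) x = rpeval p x * rpeval q x"
  by (induction p) (simp_all add: rpeval_add rpeval_smult algebra_simps mult.assoc)

lemma rpeval_diff: "rpeval (p - q) x = rpeval p x - rpeval q x"
  using rpeval_add[of p "- q" x] rpeval_smult[of "-1" q x] by simp

lemma rpeval_commute: "y * x = x * y \<Longrightarrow> y * rpeval p x = rpeval p x * y"
  unfolding rpeval_def by (rule peval_commute)

lemma self_adjoint_rpeval: "self_adjoint h \<Longrightarrow> self_adjoint (rpeval p h)"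
  by (induction p) (auto intro!: self_adjoint_add self_adjoint_scaleR self_adjoint_mult rpeval_commute)

text \<open>The root from \<open>peval_root\<close> has a singular factor, and by
  \<open>alg_invertible_nonreal\<close> nonreal points have invertible ones.\<close>

lemma spectrum_witness:
  fixes h :: "'a::unital_cstar_algebra"
  assumes "self_adjoint h" "p \<noteq> 0" "\<not> alg_invertible (rpeval p h)"
  shows "\<exists>t\<in>spectrum h. poly p t = 0"
proof -
  have "map_poly complex_of_real p \<noteq> 0" using assms(2) by (simp add: map_poly_eq_0_iff)
  then obtain z where z: "poly (map_poly complex_of_real p) z = 0" "\<not> alg_invertible (h - z *\<^sub>C 1)"
    using peval_root assms(3) unfolding rpeval_def by blast
  then have "z = complex_of_real (Re z)" using alg_invertible_nonreal[OF assms(1)] by (simp add: complex_eq_iff) blast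
  then obtain t where t: "z = complex_of_real t" by blast
  have "poly (map_poly complex_of_real p) (complex_of_real t) = complex_of_real (poly p t)"
    by (induction p) (simp_all add: map_poly_pCons)
  then show ?thesis using z t by (auto simp: spectrum_def scaleR_scaleC)
qed

text \<open>With \<open>m\<close> the norm of \<open>rpeval p h\<close>, the polynomial
  \<open>m^2 - p * p\<close> has a singular value at \<open>h\<close>, hence a root in the spectrum.
  Two different values of \<open>p\<close> keep this polynomial nonzero. For constant
  \<open>p\<close> the conclusion amounts to a nonempty spectrum, which is itself derived from this
  lemma with \<open>p\<close> the identity.\<close>

lemma norm_rpeval_attained:
  fixes h :: "'a::unital_cstar_algebra"
  assumes "self_adjoint h" "poly p u \<noteq> poly p w"
  shows "\<exists>t\<in>spectrum h. \<bar>poly p t\<bar> = norm (rpeval p h)"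
proof -
  let ?m = "norm (rpeval p h)"
  have "\<not> alg_invertible ((?m\<^sup>2) *\<^sub>R 1 - rpeval p h * rpeval p h)"
    by (rule not_invertible_norm_square[OF self_adjoint_rpeval[OF assms(1)]])
  also have "(?m\<^sup>2) *\<^sub>R 1 - rpeval p h * rpeval p h = rpeval ([:?m\<^sup>2:] - p * p) h"
    by (simp add: rpeval_diff rpeval_mult)
  finally have n: "\<not> alg_invertible (rpeval ([:?m\<^sup>2:] - p * p) h)" .
  have "[:?m\<^sup>2:] - p * p \<noteq> 0"
  proof
    assume "[:?m\<^sup>2:] - p * p = 0"
    then have "p * p = [:?m\<^sup>2:]" by simp
    then have "degree (p * p) = 0" by simp
    then have "degree p = 0" by (cases "p = 0") (auto simp: degree_mult_eq)
    then obtain c where "p = [:c:]" by (metis degree_0_id)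
    then show False using assms(2) by simp
  qed
  from spectrum_witness[OF assms(1) this n] obtain t where "t \<in> spectrum h" "?m\<^sup>2 = (poly p t)\<^sup>2"
    by (auto simp: power2_eq_square)
  then show ?thesis by (metis abs_of_nonneg norm_ge_zero power2_eq_iff abs_minus_cancel)
qed

lemma spectrum_nonempty:
  fixes h :: "'a::unital_cstar_algebra"
  assumes "self_adjoint h" shows "spectrum h \<noteq> {}"
  using norm_rpeval_attained[OF assms, of "[:0, 1:]" 0 1] by auto

lemma norm_rpeval_le:
  fixes h :: "'a::unital_cstar_algebra"
  assumes "self_adjoint h" "\<And>t. t \<in> spectrum h \<Longrightarrow> \<bar>poly p t\<bar> \<le> e"
  shows "norm (rpeval p h) \<le> e"
proof (cases "\<exists>u w. poly p u \<noteq> poly p w")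
  case True
  then show ?thesis using norm_rpeval_attained[OF assms(1)] assms(2) by metis
next
  case False
  then have "poly p = poly [:poly p 0:]" by auto
  then obtain c where c: "p = [:c:]" unfolding poly_eq_poly_eq_iff by blast
  obtain t where "t \<in> spectrum h" using spectrum_nonempty[OF assms(1)] by blast
  from assms(2)[OF this] show ?thesis by (simp add: c)
qed

text \<open>\<open>h - t\<close> is a commuting factor of \<open>p(h) - p(t)\<close>, which would be
  invertible by the Neumann series if \<open>p(t)\<close> exceeded the norm.\<close>

lemma abs_poly_le_norm_rpeval:
  fixes h :: "'a::unital_cstar_algebra"
  assumes "t \<in> spectrum h"
  shows "\<bar>poly p t\<bar> \<le> norm (rpeval p h)"
proof (rule ccontr)
  assume "\<not> \<bar>poly p t\<bar> \<le> norm (rpeval p h)"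
  then have inv: "alg_invertible (rpeval p h - poly p t *\<^sub>R 1)"
    by (intro neumann_invertible_scaled) simp
  obtain q where q: "p - [:poly p t:] = [:- t, 1:] * q"
    by (metis dvdE poly_eq_0_iff_dvd poly_diff poly_pCons poly_0 mult_zero_right add_0_right diff_self)
  have "rpeval p h - poly p t *\<^sub>R 1 = rpeval (p - [:poly p t:]) h"
    by (simp add: rpeval_diff)
  also have "\<dots> = (h - t *\<^sub>R 1) * rpeval q h"
    unfolding q rpeval_mult by simp
  finally have e: "rpeval p h - poly p t *\<^sub>R 1 = (h - t *\<^sub>R 1) * rpeval q h" .
  have "(h - t *\<^sub>R 1) * rpeval q h = rpeval q h * (h - t *\<^sub>R 1)"
    by (rule rpeval_commute) (simp add: algebra_simps)
  with alg_invertible_factors(1) inv e have "alg_invertible (h - t *\<^sub>R 1)" by metis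
  then show False using assms by (simp add: spectrum_def)
qed

section \<open>Continuous functional calculus\<close>

lemma polynomial_approximation:
  fixes f :: "real \<Rightarrow> real"
  assumes "continuous_on UNIV f"
  obtains p where "uniform_limit {-R..R} (\<lambda>n. poly (p n)) f sequentially"
proof -
  have "\<exists>q. \<forall>x\<in>{-R..R}. \<bar>poly q x - f x\<bar> < 1 / real (Suc n)" for n
  proof -
    have "continuous_on {-R..R} f" using assms continuous_on_subset by blast
    then obtain g where g: "real_polynomial_function g" "\<And>x. x \<in> {-R..R} \<Longrightarrow> \<bar>f x - g x\<bar> < 1 / real (Suc n)"
      using Stone_Weierstrass_real_polynomial_function[of "{-R..R}" f "1 / real (Suc n)"] by auto
    from g(1) obtain a m where "g = (\<lambda>x. \<Sum>i\<le>m. a i * x ^ i)"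
      unfolding real_polynomial_function_iff_sum by blast
    then have q: "g = poly (\<Sum>i\<le>m. monom (a i) i)" by (simp add: fun_eq_iff poly_sum poly_monom)
    have "\<bar>g x - f x\<bar> < 1 / real (Suc n)" if "x \<in> {-R..R}" for x
      using g(2)[OF that] by (simp only: abs_minus_commute)
    then show ?thesis unfolding q by blast
  qed
  then obtain p where p: "\<And>n x. x \<in> {-R..R} \<Longrightarrow> \<bar>poly (p n) x - f x\<bar> < 1 / real (Suc n)"
    by metis
  have "uniform_limit {-R..R} (\<lambda>n. poly (p n)) f sequentially"
  proof (rule uniform_limitI)
    fix e :: real assume "e > 0"
    then obtain N where N: "1 / real (Suc N) < e" using nat_approx_posE by blast
    show "\<forall>\<^sub>F n in sequentially. \<forall>x\<in>{-R..R}. dist (poly (p n) x) (f x) < e"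
    proof (rule eventually_sequentiallyI[of N], rule ballI)
      fix n x assume "N \<le> n" "x \<in> {-R..R}"
      have "1 / real (Suc n) \<le> 1 / real (Suc N)" using \<open>N \<le> n\<close> by (simp add: frac_le)
      with p[OF \<open>x \<in> _\<close>, of n] N show "dist (poly (p n) x) (f x) < e" by (simp add: dist_real_def)
    qed
  qed
  then show thesis using that by blast
qed

text \<open>By \<open>cfc_limit\<close> every approximating sequence has the same limit. Convergence
  is asked for on the spectrum only, so the value depends only on \<open>f\<close> there; if no
  polynomials approximate \<open>f\<close>, it is unspecified.\<close>

definition cfc :: "(real \<Rightarrow> real) \<Rightarrow> 'a::unital_cstar_algebra \<Rightarrow> 'a" where
  "cfc f h = lim (\<lambda>n. rpeval ((SOME p. uniform_limit (spectrum h) (\<lambda>n. poly (p n)) f sequentially) n) h)"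

lemma rpeval_uniform_zero:
  fixes h :: "'a::unital_cstar_algebra"
  assumes "self_adjoint h"
    and "uniform_limit (spectrum h) (\<lambda>n. poly (p n)) f sequentially"
    and "uniform_limit (spectrum h) (\<lambda>n. poly (q n)) f sequentially"
  shows "(\<lambda>n. rpeval (p n) h - rpeval (q n) h) \<longlonglongrightarrow> 0"
proof (rule tendstoI)
  fix e :: real assume "e > 0"
  \<comment> \<open>Quarters add up to \<open>e / 2\<close>; the slack is there because the spectral
    norm bound is not strict.\<close>
  then have "\<forall>\<^sub>F n in sequentially. \<forall>t\<in>spectrum h. dist (poly (p n) t) (f t) < e / 4"
    "\<forall>\<^sub>F n in sequentially. \<forall>t\<in>spectrum h. dist (poly (q n) t) (f t) < e / 4"
    using assms(2,3) by (auto dest!: uniform_limitD[where e = "e / 4"])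
  then show "\<forall>\<^sub>F n in sequentially. dist (rpeval (p n) h - rpeval (q n) h) 0 < e"
  proof eventually_elim
    case (elim n)
    have "norm (rpeval (p n - q n) h) \<le> e / 2"
    proof (rule norm_rpeval_le[OF assms(1)])
      fix t assume "t \<in> spectrum h"
      with elim have "dist (poly (p n) t) (f t) < e / 4" "dist (poly (q n) t) (f t) < e / 4" by auto
      then show "\<bar>poly (p n - q n) t\<bar> \<le> e / 2" unfolding dist_real_def poly_diff by linarith
    qed
    then show ?case using \<open>e > 0\<close> by (simp add: rpeval_diff)
  qed
qed

lemma cfc_limit:
  fixes h :: "'a::unital_cstar_algebra"
  assumes "self_adjoint h" and p: "uniform_limit (spectrum h) (\<lambda>n. poly (p n)) f sequentially"
  shows "(\<lambda>n. rpeval (p n) h) \<longlonglongrightarrow> cfc f h"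
proof -
  define q where "q = (SOME p. uniform_limit (spectrum h) (\<lambda>n. poly (p n)) f sequentially)"
  have q: "uniform_limit (spectrum h) (\<lambda>n. poly (q n)) f sequentially"
    unfolding q_def by (rule someI[of _ p]) (rule p)
  have "Cauchy (\<lambda>n. rpeval (q n) h)"
  proof (rule metric_CauchyI)
    fix e :: real assume "e > 0"
    then obtain N where N: "\<And>n t. n \<ge> N \<Longrightarrow> t \<in> spectrum h \<Longrightarrow> dist (poly (q n) t) (f t) < e / 4"
      using q unfolding uniform_limit_sequentially_iff by (metis zero_less_divide_iff zero_less_numeral)
    have "dist (rpeval (q m) h) (rpeval (q n) h) < e" if "m \<ge> N" "n \<ge> N" for m n
    proof -
      have "norm (rpeval (q m - q n) h) \<le> e / 2"
      proof (rule norm_rpeval_le[OF assms(1)])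
        fix t assume "t \<in> spectrum h"
        with N that have "dist (poly (q m) t) (f t) < e / 4" "dist (poly (q n) t) (f t) < e / 4" by auto
        then show "\<bar>poly (q m - q n) t\<bar> \<le> e / 2" unfolding dist_real_def poly_diff by linarith
      qed
      then show ?thesis using \<open>e > 0\<close> by (simp add: dist_norm rpeval_diff)
    qed
    then show "\<exists>M. \<forall>m\<ge>M. \<forall>n\<ge>M. dist (rpeval (q m) h) (rpeval (q n) h) < e" by blast
  qed
  then have "(\<lambda>n. rpeval (q n) h) \<longlonglongrightarrow> cfc f h"
    unfolding cfc_def q_def by (simp add: Cauchy_convergent convergent_LIMSEQ_iff[symmetric])
  from tendsto_add[OF this rpeval_uniform_zero[OF assms(1) p q]] show ?thesis by simp
qed

lemma spectrum_subset: "spectrum h \<subseteq> {- norm h..norm h}"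
  using spectrum_bound by fastforce

text \<open>Convergence on the whole interval is kept for two reasons: continuous functions are
  bounded there, as products require, and it contains 0, which need not be in the spectrum but
  matters for membership in nonunital subalgebras.\<close>

lemma cfc_approximation:
  fixes h :: "'a::unital_cstar_algebra"
  assumes "self_adjoint h" "continuous_on UNIV f"
  obtains p where "uniform_limit {- norm h..norm h} (\<lambda>n. poly (p n)) f sequentially"
    "uniform_limit (spectrum h) (\<lambda>n. poly (p n)) f sequentially"
    "(\<lambda>n. rpeval (p n) h) \<longlonglongrightarrow> cfc f h"
  by (metis assms cfc_limit polynomial_approximation spectrum_subset uniform_limit_on_subset)

lemma cfc_poly:
  fixes h :: "'a::unital_cstar_algebra"
  assumes "self_adjoint h" shows "cfc (poly p) h = rpeval p h"
proof -
  have "(\<lambda>n. rpeval p h) \<longlonglongrightarrow> cfc (poly p) h"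
    by (rule cfc_limit[OF assms]) (simp add: uniform_limit_const)
  then show ?thesis by (simp add: LIMSEQ_const_iff)
qed

lemma cfc_const:
  fixes h :: "'a::unital_cstar_algebra"
  assumes "self_adjoint h" shows "cfc (\<lambda>t. c) h = c *\<^sub>R 1"
proof -
  have "poly [:c:] = (\<lambda>t. c)" by (simp add: fun_eq_iff)
  then show ?thesis using cfc_poly[OF assms, of "[:c:]"] by simp
qed

lemma cfc_id:
  fixes h :: "'a::unital_cstar_algebra"
  assumes "self_adjoint h" shows "cfc (\<lambda>t. t) h = h"
proof -
  have "poly [:0, 1:] = (\<lambda>t::real. t)" by (simp add: fun_eq_iff)
  then show ?thesis using cfc_poly[OF assms, of "[:0, 1:]"] by simp
qed

lemma cfc_add:
  fixes h :: "'a::unital_cstar_algebra"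
  assumes h: "self_adjoint h" and "continuous_on UNIV f" "continuous_on UNIV g"
  shows "cfc (\<lambda>t. f t + g t) h = cfc f h + cfc g h"
proof -
  obtain p where p: "uniform_limit (spectrum h) (\<lambda>n. poly (p n)) f sequentially"
    "(\<lambda>n. rpeval (p n) h) \<longlonglongrightarrow> cfc f h" using cfc_approximation[OF h assms(2)] by blast
  obtain q where q: "uniform_limit (spectrum h) (\<lambda>n. poly (q n)) g sequentially"
    "(\<lambda>n. rpeval (q n) h) \<longlonglongrightarrow> cfc g h" using cfc_approximation[OF h assms(3)] by blast
  have "uniform_limit (spectrum h) (\<lambda>n. poly (p n + q n)) (\<lambda>t. f t + g t) sequentially"
    unfolding poly_add by (rule uniform_limit_add[OF p(1) q(1)])
  from cfc_limit[OF h this] have "(\<lambda>n. rpeval (p n) h + rpeval (q n) h) \<longlonglongrightarrow> cfc (\<lambda>t. f t + g t) h"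
    by (simp add: rpeval_add)
  with tendsto_add[OF p(2) q(2)] show ?thesis using LIMSEQ_unique by blast
qed

lemma cfc_mult:
  fixes h :: "'a::unital_cstar_algebra"
  assumes h: "self_adjoint h" and "continuous_on UNIV f" "continuous_on UNIV g"
  shows "cfc (\<lambda>t. f t * g t) h = cfc f h * cfc g h"
proof -
  obtain p where p: "uniform_limit {- norm h..norm h} (\<lambda>n. poly (p n)) f sequentially"
    "(\<lambda>n. rpeval (p n) h) \<longlonglongrightarrow> cfc f h" using cfc_approximation[OF h assms(2)] by blast
  obtain q where q: "uniform_limit {- norm h..norm h} (\<lambda>n. poly (q n)) g sequentially"
    "(\<lambda>n. rpeval (q n) h) \<longlonglongrightarrow> cfc g h" using cfc_approximation[OF h assms(3)] by blast
  have bdd: "bounded (k ` {- norm h..norm h})" if "continuous_on UNIV k" for k :: "real \<Rightarrow> real"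
    by (meson compact_Icc compact_continuous_image compact_imp_bounded continuous_on_subset subset_UNIV that)
  have "uniform_limit {- norm h..norm h} (\<lambda>n t. poly (p n) t * poly (q n) t) (\<lambda>t. f t * g t) sequentially"
    by (rule uniform_lim_mult[OF p(1) q(1) bdd[OF assms(2)] bdd[OF assms(3)]])
  then have "uniform_limit (spectrum h) (\<lambda>n. poly (p n * q n)) (\<lambda>t. f t * g t) sequentially"
    unfolding poly_mult using spectrum_subset uniform_limit_on_subset by blast
  from cfc_limit[OF h this] have "(\<lambda>n. rpeval (p n) h * rpeval (q n) h) \<longlonglongrightarrow> cfc (\<lambda>t. f t * g t) h"
    by (simp add: rpeval_mult)
  with tendsto_mult[OF p(2) q(2)] show ?thesis using LIMSEQ_unique by blast
qed

lemma cfc_cong: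
  fixes h :: "'a::unital_cstar_algebra"
  assumes h: "self_adjoint h" and f: "continuous_on UNIV f"
    and e: "\<And>t. t \<in> spectrum h \<Longrightarrow> f t = g t"
  shows "cfc f h = cfc g h"
proof -
  obtain p where p: "uniform_limit (spectrum h) (\<lambda>n. poly (p n)) f sequentially"
    "(\<lambda>n. rpeval (p n) h) \<longlonglongrightarrow> cfc f h" using cfc_approximation[OF h f] by blast
  have "uniform_limit (spectrum h) (\<lambda>n. poly (p n)) g sequentially"
    using p(1) e unfolding uniform_limit_iff by simp
  from cfc_limit[OF h this] p(2) show ?thesis using LIMSEQ_unique by blast
qed

lemma cfc_self_adjoint:
  fixes h :: "'a::unital_cstar_algebra"
  assumes "self_adjoint h" "continuous_on UNIV f"
  shows "self_adjoint (cfc f h)"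
  using cfc_approximation[OF assms] self_adjoint_lim self_adjoint_rpeval[OF assms(1)] by metis

lemma cfc_commute:
  fixes h :: "'a::unital_cstar_algebra"
  assumes "self_adjoint h" "continuous_on UNIV f" "y * h = h * y"
  shows "y * cfc f h = cfc f h * y"
proof -
  obtain p where p: "(\<lambda>n. rpeval (p n) h) \<longlonglongrightarrow> cfc f h"
    using cfc_approximation[OF assms(1,2)] by blast
  have "(\<lambda>n. y * rpeval (p n) h) \<longlonglongrightarrow> y * cfc f h" "(\<lambda>n. rpeval (p n) h * y) \<longlonglongrightarrow> cfc f h * y"
    by (intro tendsto_intros p)+
  then show ?thesis using rpeval_commute[OF assms(3)] LIMSEQ_unique by simp
qed

lemma abs_le_norm_cfc:
  fixes h :: "'a::unital_cstar_algebra"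
  assumes "self_adjoint h" "continuous_on UNIV f" "t \<in> spectrum h"
  shows "\<bar>f t\<bar> \<le> norm (cfc f h)"
proof -
  obtain p where p: "uniform_limit (spectrum h) (\<lambda>n. poly (p n)) f sequentially"
    "(\<lambda>n. rpeval (p n) h) \<longlonglongrightarrow> cfc f h" using cfc_approximation[OF assms(1,2)] by blast
  have "(\<lambda>n. \<bar>poly (p n) t\<bar>) \<longlonglongrightarrow> \<bar>f t\<bar>"
    using tendsto_uniform_limitI[OF p(1) assms(3)] tendsto_rabs by blast
  from tendsto_le[OF _ tendsto_norm[OF p(2)] this] abs_poly_le_norm_rpeval[OF assms(3)]
  show ?thesis by simp
qed

text \<open>\<open>B\<close> need not contain 1, so only polynomials without constant term stay in
  it. Since \<open>f 0 = 0\<close>, the constant terms of the approximants tend to 0 and can be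
  subtracted.\<close>

lemma cfc_mem:
  fixes h :: "'a::unital_cstar_algebra"
  assumes B: "cstar_subalgebra B" and "h \<in> B" "self_adjoint h" "continuous_on UNIV f" "f 0 = 0"
  shows "cfc f h \<in> B"
proof -
  have scaleR: "c *\<^sub>R x \<in> B" if "x \<in> B" for c x
    using B that by (simp add: cstar_subalgebra_def scaleR_scaleC)
  have mem: "rpeval (pCons 0 p) h \<in> B" for p
  proof (induction p)
    case 0
    then show ?case using B by (simp add: cstar_subalgebra_def)
  next
    case (pCons c p)
    have "rpeval (pCons 0 (pCons c p)) h = c *\<^sub>R h + h * rpeval (pCons 0 p) h"
      by (simp add: algebra_simps)
    then show ?case using B pCons.IH assms(2) scaleR by (simp add: cstar_subalgebra_def)
  qed
  obtain p where p: "uniform_limit {- norm h..norm h} (\<lambda>n. poly (p n)) f sequentially"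
    using cfc_approximation[OF assms(3,4)] by blast
  have "(\<lambda>n. poly (p n) 0) \<longlonglongrightarrow> f 0" by (rule tendsto_uniform_limitI[OF p]) simp
  then have "uniform_limit {- norm h..norm h} (\<lambda>n t. poly (p n) 0) (\<lambda>t. 0) sequentially"
    unfolding uniform_limit_iff tendsto_iff assms(5) by simp
  from uniform_limit_minus[OF p this]
  have "uniform_limit {- norm h..norm h} (\<lambda>n t. poly (p n - [:poly (p n) 0:]) t) f sequentially"
    by simp
  then have "uniform_limit (spectrum h) (\<lambda>n. poly (p n - [:poly (p n) 0:])) f sequentially"
    by (rule uniform_limit_on_subset[OF _ spectrum_subset])
  from cfc_limit[OF assms(3) this] have l: "(\<lambda>n. rpeval (p n - [:poly (p n) 0:]) h) \<longlonglongrightarrow> cfc f h" .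
  have in_B: "rpeval (q - [:poly q 0:]) h \<in> B" for q
  proof -
    obtain a r where "q = pCons a r" by (rule pCons_cases)
    then have "q - [:poly q 0:] = pCons 0 r" by simp
    then show ?thesis using mem by metis
  qed
  have "closed B" using B by (simp add: cstar_subalgebra_def)
  then show ?thesis by (rule closed_sequentially[OF _ in_B l])
qed

section \<open>Positive elements\<close>

definition nonneg :: "'a::unital_cstar_algebra \<Rightarrow> bool" where
  "nonneg a \<longleftrightarrow> self_adjoint a \<and> (\<forall>t\<in>spectrum a. 0 \<le> t)"

lemma nonneg_square:
  assumes "self_adjoint g" shows "nonneg (g * g)"
  unfolding nonneg_def
proof (intro conjI ballI)
  show "self_adjoint (g * g)" using assms by (simp add: self_adjoint_mult)
  fix t assume "t \<in> spectrum (g * g)"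
  then show "0 \<le> t"
    using alg_invertible_square_plus[OF assms, of "- t"] unfolding spectrum_def by force
qed

lemma cfc_sqrt:
  fixes a :: "'a::unital_cstar_algebra"
  assumes "nonneg a"
  defines "g \<equiv> cfc (\<lambda>t. sqrt (max 0 t)) a"
  shows "self_adjoint g" "g * g = a"
proof -
  have a: "self_adjoint a" using assms(1) by (simp add: nonneg_def)
  have c: "continuous_on UNIV (\<lambda>t::real. sqrt (max 0 t))" by (intro continuous_intros)
  show "self_adjoint g" unfolding g_def by (rule cfc_self_adjoint[OF a c])
  have "g * g = cfc (\<lambda>t. sqrt (max 0 t) * sqrt (max 0 t)) a"
    unfolding g_def by (rule cfc_mult[OF a c c, symmetric])
  also have "\<dots> = cfc (\<lambda>t. t) a"
    using assms(1) by (intro cfc_cong[OF a]) (auto intro!: continuous_intros simp: nonneg_def)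
  finally show "g * g = a" by (simp add: cfc_id[OF a])
qed

text \<open>With the converse below, positivity becomes a norm inequality. It passes to sums by the
  triangle inequality, and being a closed condition it also serves the compactness proof.\<close>

lemma nonneg_norm_le:
  fixes a :: "'a::unital_cstar_algebra"
  assumes "nonneg a" "norm a \<le> T"
  shows "norm (T *\<^sub>R 1 - a) \<le> T"
proof -
  have "norm (rpeval [:T, -1:] a) \<le> T"
  proof (rule norm_rpeval_le)
    show "self_adjoint a" using assms by (simp add: nonneg_def)
    fix t assume "t \<in> spectrum a"
    with assms spectrum_bound[OF this] show "\<bar>poly [:T, -1:] t\<bar> \<le> T" by (auto simp: nonneg_def)
  qed
  then show ?thesis by simp
qed

lemma nonneg_if_norm_le:
  fixes a :: "'a::unital_cstar_algebra"
  assumes "self_adjoint a" "norm (T *\<^sub>R 1 - a) \<le> T"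
  shows "nonneg a"
  unfolding nonneg_def
proof (intro conjI ballI)
  fix t assume "t \<in> spectrum a"
  from abs_poly_le_norm_rpeval[OF this, of "[:T, -1:]"] assms(2) show "0 \<le> t" by simp
qed (fact assms(1))

lemma nonneg_add:
  fixes a b :: "'a::unital_cstar_algebra"
  assumes "nonneg a" "nonneg b" shows "nonneg (a + b)"
proof (rule nonneg_if_norm_le)
  show "self_adjoint (a + b)" using assms by (simp add: nonneg_def self_adjoint_add)
  have "norm ((norm a *\<^sub>R 1 - a) + (norm b *\<^sub>R 1 - b)) \<le> norm a + norm b"
    by (rule order_trans[OF norm_triangle_ineq]) (intro add_mono nonneg_norm_le assms order_refl)
  then show "norm ((norm a + norm b) *\<^sub>R 1 - (a + b)) \<le> norm a + norm b"
    by (simp add: scaleR_left_distrib algebra_simps)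
qed

lemma nonneg_scaleR:
  fixes a :: "'a::unital_cstar_algebra"
  assumes "nonneg a" "c \<ge> 0" shows "nonneg (c *\<^sub>R a)"
proof (rule nonneg_if_norm_le)
  show "self_adjoint (c *\<^sub>R a)" using assms by (simp add: nonneg_def self_adjoint_scaleR)
  have "norm (c *\<^sub>R (norm a *\<^sub>R 1 - a)) \<le> c * norm a"
    using nonneg_norm_le[OF assms(1) order_refl] assms(2) by (simp add: mult_left_mono)
  then show "norm ((c * norm a) *\<^sub>R 1 - c *\<^sub>R a) \<le> c * norm a"
    by (simp add: scaleR_right_diff_distrib)
qed

lemma nonneg_minus_eq_0:
  fixes a :: "'a::unital_cstar_algebra"
  assumes "nonneg a" "nonneg (- a)" shows "a = 0"
proof -
  have a: "self_adjoint a" using assms by (simp add: nonneg_def)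
  have "t = 0" if "t \<in> spectrum a" for t
  proof -
    have "alg_invertible (- a - (- t) *\<^sub>R 1) \<Longrightarrow> alg_invertible (a - t *\<^sub>R 1)"
      using alg_invertible_minus[of "- a - (- t) *\<^sub>R 1"] by simp
    then have "- t \<in> spectrum (- a)" using that unfolding spectrum_def by blast
    then show ?thesis using that assms by (force simp: nonneg_def)
  qed
  then have "norm (rpeval [:0, 1:] a) \<le> 0" by (intro norm_rpeval_le[OF a]) auto
  then show ?thesis by simp
qed

lemma alg_invertible_mult_swap:
  fixes x y :: "'a::unital_cstar_algebra"
  assumes "alg_invertible (x * y - t *\<^sub>R 1)" "t \<noteq> 0"
  shows "alg_invertible (y * x - t *\<^sub>R 1)"
proof -
  from assms(1) obtain z where z: "(x * y - t *\<^sub>R 1) * z = 1" "z * (x * y - t *\<^sub>R 1) = 1"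
    unfolding alg_invertible_def by blast
  then have z': "x * y * z = 1 + t *\<^sub>R z" "z * (x * y) = 1 + t *\<^sub>R z"
    by (simp_all add: algebra_simps)
  \<comment> \<open>Guessed from the geometric series for \<open>1 / (y x - t)\<close>, using
    \<open>(y x)^(n+1) = y (x y)^n x\<close> and \<open>z = 1 / (x y - t)\<close>.\<close>
  let ?w = "(1 / t) *\<^sub>R (y * z * x - 1)"
  have "(y * x) * (y * z * x) = y * (x * y * z) * x" "(y * z * x) * (y * x) = y * (z * (x * y)) * x"
    by (simp_all add: mult.assoc)
  then have "(y * x) * (y * z * x) = y * x + t *\<^sub>R (y * z * x)"
    "(y * z * x) * (y * x) = y * x + t *\<^sub>R (y * z * x)"
    unfolding z' by (simp_all add: algebra_simps)
  then have "(y * x - t *\<^sub>R 1) * (y * z * x - 1) = t *\<^sub>R 1" "(y * z * x - 1) * (y * x - t *\<^sub>R 1) = t *\<^sub>R 1"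
    by (simp_all add: left_diff_distrib right_diff_distrib scaleR_right_diff_distrib)
  then have "(y * x - t *\<^sub>R 1) * ?w = 1" "?w * (y * x - t *\<^sub>R 1) = 1"
    using assms(2) by simp_all
  then show ?thesis unfolding alg_invertible_def by blast
qed

text \<open>
  If \<open>-y\<^sup>*y\<close> is positive then so is \<open>yy\<^sup>*\<close>, because \<open>y\<^sup>*y + yy\<^sup>*\<close> is a sum of squares; but \<open>y\<^sup>*y\<close> and
  \<open>yy\<^sup>*\<close> have the same nonzero spectrum.
\<close>

lemma star_mult_nonpos_eq_0:
  fixes y :: "'a::unital_cstar_algebra"
  assumes "nonneg (- (star y * y))"
  shows "star y * y = 0"
proof -
  obtain h k where hk: "self_adjoint h" "self_adjoint k" "y = h + \<i> *\<^sub>C k"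
    by (rule cartesian_decomposition)
  have "star y * y + y * star y = 2 *\<^sub>R (h * h + k * k)"
    unfolding hk(3) star_add_i_mult[OF hk(1,2)] by (rule mult_add_diff_i_sum)
  moreover have "nonneg (2 *\<^sub>R (h * h + k * k))"
    by (intro nonneg_scaleR nonneg_add nonneg_square hk) simp
  ultimately have "nonneg (star y * y + y * star y + (- (star y * y)))"
    using assms nonneg_add by metis
  then have n: "nonneg (y * star y)" by simp
  have "nonneg (star y * y)"
    unfolding nonneg_def
  proof (intro conjI ballI)
    fix t assume t: "t \<in> spectrum (star y * y)"
    show "0 \<le> t"
    proof (cases "t = 0")
      case False
      then have "t \<in> spectrum (y * star y)"
        using t alg_invertible_mult_swap unfolding spectrum_def by blast
      then show ?thesis using n by (simp add: nonneg_def)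
    qed simp
  qed (rule self_adjoint_star_mult)
  then show ?thesis using assms nonneg_minus_eq_0 by blast
qed

text \<open>Let \<open>n\<close> be the negative part of \<open>a = star x * x\<close>. Then
  \<open>y = x * n\<close> has \<open>star y * y = n * a * n = - n^3\<close>, and \<open>g\<close>
  is the root of \<open>f^3\<close> that shows this to be nonpositive. So it vanishes, and the
  spectrum of \<open>a\<close> has no negative point.\<close>

lemma nonneg_star_mult:
  fixes x :: "'a::unital_cstar_algebra"
  shows "nonneg (star x * x)"
proof -
  define a where "a = star x * x"
  have a: "self_adjoint a" unfolding a_def by (rule self_adjoint_star_mult)
  define f where "f = (\<lambda>t::real. max 0 (- t))"
  define g where "g = (\<lambda>t::real. sqrt (f t) * f t)"
  have cont: "continuous_on UNIV f" "continuous_on UNIV g" "continuous_on UNIV (\<lambda>t::real. t)"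
    unfolding f_def g_def by (intro continuous_intros)+
  define n where "n = cfc f a"
  have n: "self_adjoint n" unfolding n_def by (rule cfc_self_adjoint[OF a cont(1)])
  define y where "y = x * n"
  have "star y * y = n * (a * n)"
    using n by (simp add: y_def a_def star_mult self_adjoint_def mult.assoc)
  also have "\<dots> = cfc (\<lambda>t. f t * (t * f t)) a"
    unfolding n_def using cont by (subst (2) cfc_id[OF a, symmetric])
      (simp add: cfc_mult[OF a] continuous_on_mult)
  finally have yy: "star y * y = cfc (\<lambda>t. f t * (t * f t)) a" .
  have "star y * y + cfc g a * cfc g a = cfc (\<lambda>t. f t * (t * f t) + g t * g t) a"
    unfolding yy using cont by (simp add: cfc_add[OF a] cfc_mult[OF a] continuous_on_mult)
  also have "(\<lambda>t. f t * (t * f t) + g t * g t) = (\<lambda>t. 0)"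
  proof
    fix t :: real
    have "g t * g t = (sqrt (f t) * sqrt (f t)) * f t * f t" by (simp add: g_def)
    also have "sqrt (f t) * sqrt (f t) = f t" by (simp add: f_def)
    finally show "f t * (t * f t) + g t * g t = 0" by (simp add: f_def max_def)
  qed
  finally have "- (star y * y) = cfc g a * cfc g a"
    unfolding cfc_const[OF a] by (simp add: minus_unique)
  then have "nonneg (- (star y * y))" using nonneg_square cfc_self_adjoint[OF a cont(2)] by metis
  then have "cfc (\<lambda>t. f t * (t * f t)) a = 0" using star_mult_nonpos_eq_0 yy by metis
  then have f0: "f t * (t * f t) = 0" if "t \<in> spectrum a" for t
    using abs_le_norm_cfc[OF a _ that, of "\<lambda>t. f t * (t * f t)"] cont by (simp add: continuous_on_mult)
  have "0 \<le> t" if "t \<in> spectrum a" for t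
    using f0[OF that] by (simp add: f_def max_def split: if_splits)
  then show ?thesis using a unfolding nonneg_def a_def by blast
qed

lemma cstar_subalgebra_UNIV: "cstar_subalgebra UNIV"
  by (simp add: cstar_subalgebra_def)

text \<open>The function \<open>sqrt (max 0 t)\<close> vanishes at 0, so the root of
  \<open>a\<close> stays in \<open>B\<close>. Thus positivity of an element of \<open>B\<close> is
  the same in \<open>B\<close> and in the whole algebra.\<close>

lemma positive_in_iff:
  fixes a :: "'a::unital_cstar_algebra"
  assumes "cstar_subalgebra B"
  shows "positive_in B a \<longleftrightarrow> a \<in> B \<and> nonneg a"
proof
  assume "positive_in B a"
  then show "a \<in> B \<and> nonneg a"
    using assms nonneg_star_mult unfolding positive_in_def cstar_subalgebra_def by blast
next
  assume a: "a \<in> B \<and> nonneg a"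
  let ?g = "cfc (\<lambda>t. sqrt (max 0 t)) a"
  have "?g \<in> B" using a by (intro cfc_mem[OF assms]) (auto simp: nonneg_def intro!: continuous_intros)
  moreover have "a = star ?g * ?g" using cfc_sqrt a by (metis self_adjoint_def)
  ultimately show "positive_in B a" unfolding positive_in_def by blast
qed

section \<open>Orthogonal families\<close>

lemma self_adjoint_orthogonal_sym:
  "self_adjoint a \<Longrightarrow> self_adjoint b \<Longrightarrow> a * b = 0 \<Longrightarrow> b * a = 0"
  by (metis self_adjoint_def star_0 star_mult)

lemma norm_power_self_adjoint:
  assumes "self_adjoint x" shows "norm (x ^ 2 ^ n) = norm x ^ 2 ^ n"
proof (induction n)
  case (Suc n)
  have "x ^ 2 ^ Suc n = x ^ 2 ^ n * x ^ 2 ^ n" by (simp add: mult_2 power_add)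
  then show ?case
    using norm_square_self_adjoint[OF self_adjoint_power[OF assms]] Suc by (simp add: mult_2 power_add)
qed simp

text \<open>Orthogonality gives \<open>(a + b)^m = a^m + b^m\<close>, so the powers with exponent
  \<open>2 ^ n\<close> have norm at most 2 for every \<open>n\<close>, which forces
  \<open>norm (a + b) \<le> 1\<close>. The lower bound comes from
  \<open>a * (a + b) = a * a\<close>. Allowing \<open>norm b < 1\<close> covers the sums
  \<open>b + t c\<close> used for finite images.\<close>

lemma norm_add_orthogonal:
  fixes a b :: "'a::unital_cstar_algebra"
  assumes ab: "self_adjoint a" "self_adjoint b" "a * b = 0" and "norm a = 1" "norm b \<le> 1"
  shows "norm (a + b) = 1"
proof -
  have ba: "b * a = 0" using self_adjoint_orthogonal_sym ab by blast
  have pow: "(a + b) ^ Suc n = a ^ Suc n + b ^ Suc n" for n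
  proof (induction n)
    case (Suc n)
    have "(a + b) ^ Suc (Suc n) = (a + b) * (a ^ Suc n + b ^ Suc n)" using Suc by simp
    also have "\<dots> = a ^ Suc (Suc n) + (a * b) * b ^ n + (b * a) * a ^ n + b ^ Suc (Suc n)"
      by (simp add: algebra_simps mult.assoc)
    finally show ?case using ab(3) ba by simp
  qed simp
  have le2: "norm (a + b) ^ 2 ^ n \<le> 2" for n
  proof -
    obtain m where m: "(2::nat) ^ n = Suc m" using not0_implies_Suc by (metis power_not_zero zero_neq_numeral)
    have "norm (a ^ Suc m + b ^ Suc m) \<le> norm a ^ Suc m + norm b ^ Suc m"
      by (intro order_trans[OF norm_triangle_ineq] add_mono norm_power_ineq)
    also have "\<dots> \<le> 1 + 1" using assms(4,5) by (intro add_mono power_le_one) auto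
    finally show ?thesis
      using norm_power_self_adjoint[OF self_adjoint_add[OF ab(1,2)], of n] unfolding m pow by simp
  qed
  have "norm (a + b) \<le> 1"
  proof (rule ccontr)
    assume "\<not> norm (a + b) \<le> 1"
    then obtain n where "2 < norm (a + b) ^ n" using real_arch_pow by fastforce
    also have "\<dots> \<le> norm (a + b) ^ 2 ^ n"
      using \<open>\<not> norm (a + b) \<le> 1\<close> by (intro power_increasing) (auto simp: less_imp_le)
    finally show False using le2[of n] by simp
  qed
  moreover have "1 \<le> norm (a + b)"
  proof -
    have "norm (a * a) \<le> norm a * norm (a + b)"
      using norm_mult_ineq[of a "a + b"] ab(3) by (simp add: algebra_simps)
    then show ?thesis using norm_square_self_adjoint[OF ab(1)] assms(4) by simp
  qed
  ultimately show ?thesis by simp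
qed

definition orth_family :: "'a::unital_cstar_algebra set \<Rightarrow> bool" where
  "orth_family F \<longleftrightarrow> finite F \<and> (\<forall>a\<in>F. nonneg a \<and> norm a = 1) \<and> (\<forall>a\<in>F. \<forall>b\<in>F. a \<noteq> b \<longrightarrow> a * b = 0)"

lemma nonneg_1: "nonneg 1"
  using nonneg_square[OF self_adjoint_1] by simp

lemma orth_family_1: "orth_family {1}"
  by (simp add: orth_family_def nonneg_1)

lemma nonneg_cfc:
  fixes h :: "'a::unital_cstar_algebra"
  assumes h: "self_adjoint h" "continuous_on UNIV f" "\<And>t. 0 \<le> f t"
  shows "nonneg (cfc f h)"
proof -
  have c: "continuous_on UNIV (\<lambda>t. sqrt (f t))" using assms(2) by (intro continuous_intros)
  have "cfc f h = cfc (\<lambda>t. sqrt (f t) * sqrt (f t)) h" using assms(3) by simp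
  also have "\<dots> = cfc (\<lambda>t. sqrt (f t)) h * cfc (\<lambda>t. sqrt (f t)) h" by (rule cfc_mult[OF h(1) c c])
  finally show ?thesis using nonneg_square[OF cfc_self_adjoint[OF h(1) c]] by simp
qed

text \<open>
  The functions \<open>t \<mapsto> (d(t, X - {x}) - |t - x|)\<^sup>+\<close>, for \<open>x\<close> in the finite set \<open>X\<close>, have disjoint supports.
\<close>

lemma orth_family_of_spectrum:
  fixes h :: "'a::unital_cstar_algebra"
  assumes h: "self_adjoint h" and X: "finite X" "X \<subseteq> spectrum h" "2 \<le> card X"
  shows "\<exists>F :: 'a set. orth_family F \<and> card F = card X"
proof -
  define f where "f x t = max 0 (infdist t (X - {x}) - \<bar>t - x\<bar>)" for x t :: real
  define c where "c x = cfc (f x) h" for x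
  have cont: "continuous_on UNIV (f x)" for x
    unfolding f_def by (intro continuous_intros)
  have disjoint: "f x t * f y t = 0" if "x \<in> X" "y \<in> X" "x \<noteq> y" for x y t
  proof (rule ccontr)
    assume "f x t * f y t \<noteq> 0"
    then have "\<bar>t - x\<bar> < infdist t (X - {x})" "\<bar>t - y\<bar> < infdist t (X - {y})"
      by (auto simp: f_def max_def split: if_splits)
    moreover have "infdist t (X - {x}) \<le> \<bar>t - y\<bar>" "infdist t (X - {y}) \<le> \<bar>t - x\<bar>"
      using that infdist_le[of y "X - {x}" t] infdist_le[of x "X - {y}" t] by (auto simp: dist_real_def)
    ultimately show False by simp
  qed
  have c_orth: "c x * c y = 0" if "x \<in> X" "y \<in> X" "x \<noteq> y" for x y
  proof -
    have "c x * c y = cfc (\<lambda>t. f x t * f y t) h" unfolding c_def by (rule cfc_mult[OF h cont cont, symmetric])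
    then show ?thesis using disjoint[OF that] cfc_const[OF h, of 0] by simp
  qed
  have c_nonneg: "nonneg (c x)" for x
    unfolding c_def by (rule nonneg_cfc[OF h cont]) (simp add: f_def)
  have c_nonzero: "c x \<noteq> 0" if "x \<in> X" for x
  proof -
    \<comment> \<open>\<open>infdist\<close> to the empty set is 0, so for a single point the bump
      would vanish; hence the bound on \<open>card X\<close>.\<close>
    have "X - {x} \<noteq> {}"
    proof
      assume "X - {x} = {}"
      then have "X = {x}" using that by blast
      then show False using X(3) by simp
    qed
    then have "0 < infdist x (X - {x})"
      using X(1) by (intro infdist_pos_not_in_closed finite_imp_closed) auto
    then have "0 < \<bar>f x x\<bar>" by (simp add: f_def)
    also have "\<dots> \<le> norm (c x)" unfolding c_def using that X(2) by (intro abs_le_norm_cfc[OF h cont]) blast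
    finally show ?thesis by auto
  qed
  define a where "a x = (1 / norm (c x)) *\<^sub>R c x" for x
  have a_norm: "norm (a x) = 1" if "x \<in> X" for x using c_nonzero[OF that] by (simp add: a_def)
  have a_nonneg: "nonneg (a x)" for x unfolding a_def by (intro nonneg_scaleR c_nonneg) simp
  have a_orth: "a x * a y = 0" if "x \<in> X" "y \<in> X" "x \<noteq> y" for x y
    using c_orth[OF that] by (simp add: a_def)
  have "inj_on a X"
  proof (rule inj_onI, rule ccontr)
    fix x y assume xy: "x \<in> X" "y \<in> X" "a x = a y" "x \<noteq> y"
    then have "a x * a x = 0" using a_orth by metis
    then show False
      using norm_square_self_adjoint[of "a x"] a_norm[OF xy(1)] a_nonneg[of x] by (simp add: nonneg_def)
  qed
  moreover have "orth_family (a ` X)"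
    using X(1) a_norm a_nonneg a_orth unfolding orth_family_def by auto
  ultimately show ?thesis using card_image by blast
qed

lemma spectrum_card_le:
  fixes h :: "'a::unital_cstar_algebra"
  assumes N: "\<And>F :: 'a set. orth_family F \<Longrightarrow> card F \<le> N" and h: "self_adjoint h"
  shows "finite (spectrum h)" "card (spectrum h) \<le> N"
proof -
  have "card X \<le> N" if X: "X \<subseteq> spectrum h" "finite X" for X
  proof (cases "2 \<le> card X")
    case True
    then show ?thesis using orth_family_of_spectrum[OF h X(2,1)] N by metis
  next
    case False
    \<comment> \<open>The family \<open>{1}\<close> accounts for sets of at most one point, which
      the bump construction does not cover.\<close>
    moreover have "1 \<le> N" using N[OF orth_family_1] by simp
    ultimately show ?thesis by linarith
  qed
  then have "finite (spectrum h) \<and> card (spectrum h) \<le> N"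
    using finite_if_finite_subsets_card_bdd by blast
  then show "finite (spectrum h)" "card (spectrum h) \<le> N" by auto
qed

section \<open>Projections\<close>

lemma projection_self_adjoint: "projection p \<Longrightarrow> self_adjoint p"
  by (simp add: projection_def self_adjoint_def)

lemma projection_nonneg: "projection p \<Longrightarrow> nonneg p"
  using nonneg_square[OF projection_self_adjoint] by (metis projection_def)

lemma projection_norm:
  assumes "projection p" "p \<noteq> 0" shows "norm p = 1"
  using norm_square_self_adjoint[OF projection_self_adjoint[OF assms(1)]] assms
  by (simp add: projection_def)

text \<open>For projections, \<open>p * e = e\<close> is the order relation
  \<open>e \<le> p\<close>.\<close>

definition minimal_projection :: "'a::unital_cstar_algebra \<Rightarrow> bool" where
  "minimal_projection p \<longleftrightarrow> projection p \<and> p \<noteq> 0 \<and>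
     (\<forall>e. projection e \<and> p * e = e \<longrightarrow> e = 0 \<or> e = p)"

lemma cfc_sum:
  fixes h :: "'a::unital_cstar_algebra"
  assumes h: "self_adjoint h" and f: "\<And>i. i \<in> I \<Longrightarrow> continuous_on UNIV (f i)" and "finite I"
  shows "cfc (\<lambda>t. \<Sum>i\<in>I. f i t) h = (\<Sum>i\<in>I. cfc (f i) h)"
  using assms(3) f
proof (induction I)
  case empty
  show ?case using cfc_const[OF h, of 0] by simp
next
  case (insert i I)
  then have "cfc (\<lambda>t. f i t + (\<Sum>j\<in>I. f j t)) h = cfc (f i) h + cfc (\<lambda>t. \<Sum>j\<in>I. f j t) h"
    by (intro cfc_add[OF h] continuous_on_sum) auto
  with insert show ?case by simp
qed

lemma spectral_projections:
  fixes h :: "'a::unital_cstar_algebra"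
  assumes h: "self_adjoint h" and fin: "finite (spectrum h)"
  obtains e where "\<And>x. x \<in> spectrum h \<Longrightarrow> projection (e x)" "\<And>x. x \<in> spectrum h \<Longrightarrow> h * e x = x *\<^sub>R e x"
    "(\<Sum>x\<in>spectrum h. e x) = 1" "\<And>x y. y * h = h * y \<Longrightarrow> y * e x = e x * y"
proof -
  \<comment> \<open>Lagrange basis polynomials: on the finite spectrum they are the indicators of
    single points, yet they are continuous on the whole line.\<close>
  define f where "f x t = (\<Prod>y\<in>spectrum h - {x}. (t - y) / (x - y))" for x t :: real
  have f_eq: "f x t = (if t = x then 1 else 0)" if "x \<in> spectrum h" "t \<in> spectrum h" for x t
    using that fin unfolding f_def by (auto intro!: prod.neutral prod_zero)
  have cont: "continuous_on UNIV (f x)" for x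
    unfolding f_def by (intro continuous_on_prod continuous_on_divide continuous_intros) auto
  define e where "e x = cfc (f x) h" for x
  have "projection (e x)" if x: "x \<in> spectrum h" for x
  proof -
    have "e x * e x = cfc (\<lambda>t. f x t * f x t) h" unfolding e_def by (rule cfc_mult[OF h cont cont, symmetric])
    also have "\<dots> = e x"
      unfolding e_def using x by (intro cfc_cong[OF h] continuous_on_mult cont) (simp add: f_eq)
    finally show ?thesis
      using cfc_self_adjoint[OF h cont] by (simp add: projection_def self_adjoint_def e_def)
  qed
  moreover have "h * e x = x *\<^sub>R e x" if x: "x \<in> spectrum h" for x
  proof -
    have "h * e x = cfc (\<lambda>t. t) h * cfc (f x) h" by (simp add: e_def cfc_id[OF h])
    also have "\<dots> = cfc (\<lambda>t. t * f x t) h"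
      by (rule cfc_mult[OF h _ cont, symmetric]) (intro continuous_intros)
    also have "\<dots> = cfc (\<lambda>t. x * f x t) h"
      using x by (intro cfc_cong[OF h] continuous_on_mult cont continuous_intros) (simp add: f_eq)
    also have "\<dots> = cfc (\<lambda>t. x) h * cfc (f x) h"
      by (rule cfc_mult[OF h _ cont]) (intro continuous_intros)
    finally show ?thesis by (simp add: e_def cfc_const[OF h])
  qed
  moreover have "(\<Sum>x\<in>spectrum h. e x) = 1"
  proof -
    have "(\<Sum>x\<in>spectrum h. e x) = cfc (\<lambda>t. \<Sum>x\<in>spectrum h. f x t) h"
      unfolding e_def by (rule cfc_sum[OF h cont fin, symmetric])
    also have "\<dots> = cfc (\<lambda>t. 1) h"
      using fin by (intro cfc_cong[OF h] continuous_on_sum cont) (simp add: f_eq)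
    finally show ?thesis by (simp add: cfc_const[OF h])
  qed
  moreover have "y * e x = e x * y" if "y * h = h * y" for x y
    unfolding e_def by (rule cfc_commute[OF h cont that])
  ultimately show thesis using that by blast
qed

lemma projection_mult_commute:
  "projection p \<Longrightarrow> projection q \<Longrightarrow> p * q = q * p \<Longrightarrow> projection (p * q)"
  unfolding projection_def by (metis mult.assoc star_mult)

text \<open>The spectral projections of \<open>h = p * k * p\<close> commute with \<open>p\<close>,
  so each is cut down by \<open>p\<close> to 0 or \<open>p\<close>. They sum to 1, so one of them
  gives \<open>p\<close>, and there \<open>h\<close> acts as its eigenvalue. The general case
  follows from real and imaginary parts.\<close>

lemma minimal_projection_corner:
  fixes p :: "'a::unital_cstar_algebra"
  assumes fin: "\<And>h :: 'a. self_adjoint h \<Longrightarrow> finite (spectrum h)" and min: "minimal_projection p"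
  shows "\<exists>c. p * x * p = c *\<^sub>C p"
proof -
  have p: "projection p" "p \<noteq> 0" "star p = p" "p * p = p"
    using min by (auto simp: minimal_projection_def projection_def)
  have sa: "\<exists>r. p * k * p = r *\<^sub>R p" if k: "self_adjoint k" for k
  proof -
    define h where "h = p * k * p"
    have h: "self_adjoint h" using k p(3) by (simp add: h_def self_adjoint_def star_mult mult.assoc)
    have ph: "p * h = h" "h * p = h" using p(4) unfolding h_def by (metis mult.assoc)+
    obtain e where e: "\<And>x. x \<in> spectrum h \<Longrightarrow> projection (e x)" "\<And>x. x \<in> spectrum h \<Longrightarrow> h * e x = x *\<^sub>R e x"
      "(\<Sum>x\<in>spectrum h. e x) = 1" "\<And>x y. y * h = h * y \<Longrightarrow> y * e x = e x * y"
      using spectral_projections[OF h fin[OF h]] by blast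
    have pe: "p * e x = e x * p" for x using e(4) ph by simp
    have "p * e x = 0 \<or> p * e x = p" if "x \<in> spectrum h" for x
      using min projection_mult_commute[OF p(1) e(1)[OF that] pe] p(4)
      unfolding minimal_projection_def by (metis mult.assoc)
    moreover have "\<not> (\<forall>x\<in>spectrum h. p * e x = 0)"
    proof
      assume "\<forall>x\<in>spectrum h. p * e x = 0"
      then have "p * (\<Sum>x\<in>spectrum h. e x) = 0" by (simp add: sum_distrib_left)
      then show False using e(3) p(2) by simp
    qed
    ultimately obtain x where x: "x \<in> spectrum h" "p * e x = p" by blast
    then have "h = h * (e x * p)" using ph(2) pe by metis
    also have "\<dots> = x *\<^sub>R (e x * p)" using e(2)[OF x(1)] by (simp add: mult.assoc[symmetric])
    also have "\<dots> = x *\<^sub>R p" using x(2) pe by metis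
    finally show ?thesis unfolding h_def by blast
  qed
  obtain a b where ab: "self_adjoint a" "self_adjoint b" "x = a + \<i> *\<^sub>C b"
    by (rule cartesian_decomposition)
  from sa[OF ab(1)] sa[OF ab(2)] obtain r s where "p * a * p = r *\<^sub>R p" "p * b * p = s *\<^sub>R p" by blast
  then have "p * x * p = complex_of_real r *\<^sub>C p + (\<i> * complex_of_real s) *\<^sub>C p"
    unfolding ab(3) by (simp add: algebra_simps mult_scaleC_left mult_scaleC_right scaleR_scaleC scaleC_scaleC)
  then show ?thesis by (metis scaleC_add_left)
qed

text \<open>A nonzero \<open>v\<close> in the corner has \<open>v * star v = l p\<close> with
  \<open>l\<close> nonzero, while \<open>star v * (p * x * q)\<close> is a multiple of
  \<open>q\<close>. Multiplying the latter by \<open>v\<close> from the left exhibits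
  \<open>l p x q\<close> as a multiple of \<open>v\<close>.\<close>

lemma corner_one_dimensional:
  fixes p q :: "'a::unital_cstar_algebra"
  assumes p: "projection p" "\<And>x. \<exists>c. p * x * p = c *\<^sub>C p"
    and q: "projection q" "\<And>x. \<exists>c. q * x * q = c *\<^sub>C q"
  shows "\<exists>v. \<forall>x. \<exists>c. p * x * q = c *\<^sub>C v"
proof (cases "\<forall>x. p * x * q = 0")
  case True
  then show ?thesis by (metis cvs.scale_zero_left)
next
  case False
  then obtain x0 where v0: "p * x0 * q \<noteq> 0" by blast
  define v where "v = p * x0 * q"
  have pp: "star p = p" "p * p = p" "star q = q" "q * q = q" using p q by (auto simp: projection_def)
  have vq: "v * q = v" using pp by (simp add: v_def mult.assoc)
  then have qv: "q * star v = star v" using pp(3) by (metis star_mult)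
  have "v * star v = p * (x0 * q * star x0) * p"
    using pp by (simp add: v_def star_mult) (metis mult.assoc)
  then obtain l where l: "v * star v = l *\<^sub>C p" using p(2) by metis
  have "norm (v * star v) = norm v ^ 2" using cstar_identity[of "star v"] by (simp add: star_star)
  then have "l \<noteq> 0" using l v0 by (auto simp: v_def)
  have "\<exists>c. p * x * q = c *\<^sub>C v" for x
  proof -
    have "star v * (p * x * q) = q * (star v * p * x) * q" using qv by (metis mult.assoc)
    then obtain c where c: "star v * (p * x * q) = c *\<^sub>C q" using q(2) by metis
    have "l *\<^sub>C (p * x * q) = (l *\<^sub>C p) * (p * x * q)"
      using pp(2) by (simp add: mult_scaleC_left mult.assoc[symmetric])
    also have "\<dots> = v * (star v * (p * x * q))" unfolding l[symmetric] by (simp add: mult.assoc)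
    also have "\<dots> = c *\<^sub>C v" unfolding c using vq by (simp add: mult_scaleC_right)
    finally have "inverse l *\<^sub>C l *\<^sub>C (p * x * q) = (inverse l * c) *\<^sub>C v" by (simp add: scaleC_scaleC)
    then show ?thesis using \<open>l \<noteq> 0\<close> by (auto simp: scaleC_scaleC)
  qed
  then show ?thesis by blast
qed

text \<open>A member \<open>p\<close> that is not minimal could be replaced by some \<open>e\<close>
  below it together with \<open>p - e\<close>, which keeps the sum and enlarges the family.\<close>

lemma minimal_projection_decomposition:
  assumes N: "\<And>F :: 'a::unital_cstar_algebra set. orth_family F \<Longrightarrow> card F \<le> N"
  obtains F :: "'a::unital_cstar_algebra set" where "orth_family F" "\<And>p. p \<in> F \<Longrightarrow> minimal_projection p" "\<Sum>F = 1"
proof -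
  define P where "P F \<longleftrightarrow> orth_family F \<and> (\<forall>p\<in>F. projection p) \<and> \<Sum>F = 1" for F :: "'a set"
  have "P {1}" by (simp add: P_def orth_family_1 projection_def)
  moreover have "\<forall>F. P F \<longrightarrow> card F < Suc N" using N by (auto simp: P_def less_Suc_eq_le)
  ultimately obtain F where F: "P F" and max: "\<And>G. P G \<Longrightarrow> card G \<le> card F"
    using ex_has_greatest_nat[of P "{1}" card "Suc N"] by blast
  have fin: "finite F" using F by (simp add: P_def orth_family_def)
  have min: "minimal_projection p" if pF: "p \<in> F" for p
  proof (rule ccontr)
    assume nmin: "\<not> minimal_projection p"
    have p: "projection p" "p \<noteq> 0" using F pF by (auto simp: P_def orth_family_def)
    then obtain e where e: "projection e" "p * e = e" "e \<noteq> 0" "e \<noteq> p"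
      using nmin by (auto simp: minimal_projection_def)
    have ep: "e * p = e" using p(1) e(1,2) unfolding projection_def by (metis star_mult)
    define d where "d = p - e"
    have d: "projection d" "d \<noteq> 0"
      using p e ep unfolding d_def projection_def by (simp_all add: star_diff algebra_simps)
    have ed: "e * d = 0" "d * e = 0"
      using e(1,2) ep unfolding d_def projection_def by (simp_all add: algebra_simps)
    have orth: "q * p = 0" "p * q = 0" if "q \<in> F - {p}" for q
      using F pF that unfolding P_def orth_family_def by auto
    have orth_e: "q * e = 0" "e * q = 0" if "q \<in> F - {p}" for q
      using orth[OF that] e(2) ep by (metis mult.assoc mult_zero_left mult_zero_right)+
    have orth_d: "q * d = 0" "d * q = 0" if "q \<in> F - {p}" for q
      using orth[OF that] orth_e[OF that] by (simp_all add: d_def algebra_simps)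
    \<comment> \<open>Any coincidence would make a nonzero projection orthogonal to itself.\<close>
    have notin: "e \<notin> F - {p}" "d \<notin> F - {p}" "e \<noteq> d"
      using orth_e(1)[of e] orth_d(1)[of d] e(1,3) d ed unfolding projection_def by metis+
    define G where "G = insert e (insert d (F - {p}))"
    have "card G = Suc (Suc (card (F - {p})))"
      using notin fin by (simp add: G_def)
    also have "\<dots> = Suc (card F)" by (simp only: card_Suc_Diff1[OF fin pF])
    finally have "card G > card F" by simp
    moreover have "P G"
      unfolding P_def orth_family_def
    proof (intro conjI)
      show "finite G" using fin by (simp add: G_def)
      show proj: "\<forall>q\<in>G. projection q" using F e(1) d(1) by (auto simp: G_def P_def)
      have "q \<noteq> 0" if "q \<in> G" for q
        using that F e(3) d(2) by (auto simp: G_def P_def orth_family_def)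
      then show "\<forall>q\<in>G. nonneg q \<and> norm q = 1" using proj projection_nonneg projection_norm by blast
      have "a * b = 0" if "a \<in> F - {p}" "b \<in> F - {p}" "a \<noteq> b" for a b
        using F that by (auto simp: P_def orth_family_def)
      then show "\<forall>a\<in>G. \<forall>b\<in>G. a \<noteq> b \<longrightarrow> a * b = 0"
        using orth_e orth_d ed unfolding G_def by blast
      have "\<Sum>G = e + (d + \<Sum>(F - {p}))" using notin fin by (simp add: G_def)
      also have "\<dots> = p + \<Sum>(F - {p})" by (simp add: d_def)
      also have "\<dots> = 1" using sum.remove[OF fin pF, of "\<lambda>x. x"] F by (simp add: P_def)
      finally show "\<Sum>G = 1" .
    qed
    ultimately show False using max by fastforce
  qed
  show thesis by (rule that[of F]) (use F min in \<open>simp_all add: P_def\<close>)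
qed

lemma finite_dimensional_if_bounded:
  assumes N: "\<And>F :: 'a::unital_cstar_algebra set. orth_family F \<Longrightarrow> card F \<le> N"
  shows "finite_dimensional TYPE('a)"
proof -
  obtain F :: "'a set" where F: "orth_family F" "\<And>p. p \<in> F \<Longrightarrow> minimal_projection p" "\<Sum>F = 1"
    using minimal_projection_decomposition[OF N] by blast
  have fin: "finite F" using F by (simp add: orth_family_def)
  have corner: "\<exists>c. p * x * p = c *\<^sub>C p" if "p \<in> F" for p x
    using minimal_projection_corner[OF spectrum_card_le(1)[OF N] F(2)[OF that]] by blast
  have "\<exists>v. \<forall>x. \<exists>c. p * x * q = c *\<^sub>C v" if "p \<in> F" "q \<in> F" for p q
    using that F(2) corner by (intro corner_one_dimensional) (auto simp: minimal_projection_def)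
  then obtain v where v: "\<And>p q x. p \<in> F \<Longrightarrow> q \<in> F \<Longrightarrow> \<exists>c. p * x * q = c *\<^sub>C v p q" by metis
  let ?S = "(\<lambda>(p, q). v p q) ` (F \<times> F)"
  have "x \<in> cvs.span ?S" for x
  proof -
    have "x = (\<Sum>F) * x * (\<Sum>F)" using F(3) by simp
    also have "\<dots> = (\<Sum>p\<in>F. \<Sum>q\<in>F. p * x * q)"
      by (simp only: sum_distrib_left sum_distrib_right) (rule sum.swap)
    also have "\<dots> \<in> cvs.span ?S"
    proof (intro cvs.span_sum)
      fix p q assume pq: "p \<in> F" "q \<in> F"
      from v[OF pq] obtain c where "p * x * q = c *\<^sub>C v p q" by blast
      moreover have "v p q \<in> ?S" using pq by force
      ultimately show "p * x * q \<in> cvs.span ?S" by (simp add: cvs.span_base cvs.span_scale)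
    qed
    finally show ?thesis .
  qed
  then show ?thesis unfolding finite_dimensional_def using fin
    by (intro exI[of _ ?S]) auto
qed

section \<open>The addition map\<close>

lemma in_add_dom_iff:
  fixes a b :: "'a::unital_cstar_algebra"
  assumes "cstar_subalgebra B"
  shows "(a, b) \<in> add_dom B \<longleftrightarrow>
    a \<in> B \<and> b \<in> B \<and> nonneg a \<and> nonneg b \<and> norm a = 1 \<and> norm b = 1 \<and> a * b = 0"
  unfolding add_dom_def by (auto simp: positive_in_iff[OF assms])

lemmas in_add_dom_UNIV_iff = in_add_dom_iff[OF cstar_subalgebra_UNIV, simplified]

lemma norm_add_dom:
  fixes a b :: "'a::unital_cstar_algebra"
  assumes "(a, b) \<in> add_dom UNIV" shows "norm (a + b) = 1"
  using assms norm_add_orthogonal[of a b] by (simp add: in_add_dom_UNIV_iff nonneg_def)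

lemma add_dom_of_orth_family:
  assumes "orth_family F" "a \<in> F" "b \<in> F" "a \<noteq> b"
  shows "(a, b) \<in> add_dom UNIV"
  using assms by (auto simp: in_add_dom_UNIV_iff orth_family_def)

lemma spectrum_singleton_scalar:
  fixes h :: "'a::unital_cstar_algebra"
  assumes "self_adjoint h" "spectrum h \<subseteq> {x}"
  shows "h = x *\<^sub>R 1"
proof -
  have "norm (rpeval [:- x, 1:] h) \<le> 0"
    using assms(2) by (intro norm_rpeval_le[OF assms(1)]) auto
  then show ?thesis by simp
qed

text \<open>If all self-adjoint elements were real multiples of 1, the algebra would consist of
  scalars. A self-adjoint element of another kind has two spectral points, and these are separated
  by orthogonal elements.\<close>

lemma add_dom_nonempty:
  assumes "\<not> only_scalars TYPE('a::unital_cstar_algebra)"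
  shows "add_dom (UNIV :: 'a set) \<noteq> {}"
proof -
  have "\<exists>h :: 'a. self_adjoint h \<and> (\<forall>r. h \<noteq> r *\<^sub>R 1)"
  proof (rule ccontr)
    assume *: "\<not> ?thesis"
    have "\<exists>c. x = c *\<^sub>C 1" for x :: 'a
    proof -
      obtain h k where hk: "self_adjoint h" "self_adjoint k" "x = h + \<i> *\<^sub>C k"
        by (rule cartesian_decomposition)
      with * obtain r s where "h = r *\<^sub>R 1" "k = s *\<^sub>R 1" by blast
      then have "x = complex_of_real r *\<^sub>C 1 + (\<i> * complex_of_real s) *\<^sub>C 1"
        using hk(3) by (simp add: scaleR_scaleC scaleC_scaleC)
      then show ?thesis by (metis scaleC_add_left)
    qed
    then show False using assms by (simp add: only_scalars_def)
  qed
  then obtain h :: 'a where h: "self_adjoint h" "\<And>r. h \<noteq> r *\<^sub>R 1" by blast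
  obtain x where x: "x \<in> spectrum h" using spectrum_nonempty[OF h(1)] by blast
  then obtain y where y: "y \<in> spectrum h" "y \<noteq> x" using spectrum_singleton_scalar[OF h(1), of x] h(2) by blast
  obtain F :: "'a set" where F: "orth_family F" "card F = 2"
    using orth_family_of_spectrum[OF h(1), of "{x, y}"] x y by auto
  then obtain a b where "F = {a, b}" "a \<noteq> b" by (meson card_2_iff)
  then show ?thesis using add_dom_of_orth_family[OF F(1)] by blast
qed

lemma norm_add_dom_diff_1_le:
  fixes a b :: "'a::unital_cstar_algebra"
  assumes "(a, b) \<in> add_dom UNIV" shows "norm (a + b - 1) \<le> 1"
proof -
  have "nonneg (a + b)" using assms by (simp add: in_add_dom_UNIV_iff nonneg_add)
  from nonneg_norm_le[OF this, of 1] norm_add_dom[OF assms] show ?thesis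
    by (simp add: norm_minus_commute)
qed

text \<open>If \<open>c = a + b\<close> is invertible, then \<open>a c\<^sup>-\<^sup>1\<close> is a projection.\<close>

lemma nontrivial_projection_if_near_1:
  fixes a b :: "'a::unital_cstar_algebra"
  assumes ab: "(a, b) \<in> add_dom UNIV" and near: "norm (a + b - 1) < 1"
  shows "\<exists>p :: 'a. nontrivial_projection p"
proof -
  have a: "star a = a" "star b = b" "norm a = 1" "norm b = 1" "a * b = 0"
    using ab by (auto simp: in_add_dom_UNIV_iff nonneg_def self_adjoint_def)
  then have ba: "b * a = 0" using self_adjoint_orthogonal_sym by (simp add: self_adjoint_def)
  define c where "c = a + b"
  have "norm (1 - c) < 1" using near by (simp add: c_def norm_minus_commute)
  from neumann_invertible[OF this] have "alg_invertible c" by simp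
  then obtain r where r: "c * r = 1" "r * c = 1" unfolding alg_invertible_def by blast
  have ac: "a * c = a * a" "c * a = a * a" using a(5) ba by (simp_all add: c_def algebra_simps)
  have ar: "a * r = r * a"
  proof -
    have "a * r = r * (c * a) * r" using r(2) by (simp add: mult.assoc[symmetric])
    also have "\<dots> = r * (a * c) * r" by (simp only: ac)
    also have "\<dots> = r * a * (c * r)" by (simp only: mult.assoc)
    finally show ?thesis using r(1) by simp
  qed
  have "star r = r"
  proof -
    have "star r * c = 1" using arg_cong[OF r(1), of star] a(1,2) by (simp add: star_mult star_add c_def)
    then show ?thesis using r(1) by (metis mult.assoc mult.right_neutral mult_1_left)
  qed
  define p where "p = a * r"
  have "star p = p" using a(1) \<open>star r = r\<close> ar by (simp add: p_def star_mult)
  moreover have "p * p = p"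
  proof -
    have "p * p = a * a * r * r" unfolding p_def using ar by (metis mult.assoc)
    also have "\<dots> = a * (c * r) * r" unfolding ac(1)[symmetric] by (simp only: mult.assoc)
    finally show ?thesis using r(1) by (simp add: p_def)
  qed
  moreover have pc: "p * c = a" using r(2) by (simp add: p_def mult.assoc)
  \<comment> \<open>From \<open>p * c = a\<close>: \<open>p = 0\<close> would give
    \<open>a = 0\<close>, and \<open>p = 1\<close> would give \<open>b = 0\<close>.\<close>
  then have "p \<noteq> 0" using a(3) by auto
  moreover have "p \<noteq> 1" using pc a(4) by (auto simp: c_def)
  ultimately show ?thesis unfolding nontrivial_projection_def projection_def by blast
qed

lemma add_dom_of_projection:
  fixes p :: "'a::unital_cstar_algebra"
  assumes "nontrivial_projection p" shows "(p, 1 - p) \<in> add_dom UNIV"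
proof -
  have p: "projection p" "p \<noteq> 0" "p \<noteq> 1" using assms by (auto simp: nontrivial_projection_def)
  then have "projection (1 - p)" by (simp add: projection_def star_diff algebra_simps)
  with p show ?thesis
    unfolding in_add_dom_UNIV_iff
    by (auto intro!: projection_nonneg projection_norm) (simp add: projection_def algebra_simps)
qed

text \<open>A nontrivial projection \<open>p\<close> attains distance 0 with the pair
  \<open>(p, 1 - p)\<close>. Otherwise every pair is at distance exactly 1, so the infimum runs over
  a constant.\<close>

lemma unit_dist_cases:
  assumes "\<not> only_scalars TYPE('a::unital_cstar_algebra)"
  shows "unit_dist TYPE('a) = (if \<exists>p :: 'a. nontrivial_projection p then 0 else 1)"
proof -
  let ?D = "add_dom (UNIV :: 'a set)" and ?f = "\<lambda>(a, b). norm (a + b - 1 :: 'a)"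
  have ne: "?D \<noteq> {}" by (rule add_dom_nonempty[OF assms])
  have bdd: "bdd_below (?f ` ?D)" by (rule bdd_belowI[of _ 0]) auto
  show ?thesis
  proof (cases "\<exists>p :: 'a. nontrivial_projection p")
    case True
    then obtain p :: 'a where p: "nontrivial_projection p" by blast
    have "Inf (?f ` ?D) \<le> ?f (p, 1 - p)" by (rule cINF_lower[OF bdd add_dom_of_projection[OF p]])
    moreover have "0 \<le> Inf (?f ` ?D)" using ne by (intro cINF_greatest) auto
    ultimately show ?thesis using True by (simp add: unit_dist_def)
  next
    case False
    then have eq: "?f x = 1" if "x \<in> ?D" for x
      using that nontrivial_projection_if_near_1 norm_add_dom_diff_1_le by (cases x) fastforce
    have "?f ` ?D = {1}" using ne eq by (auto simp: image_iff)
    then show ?thesis using False by (simp add: unit_dist_def)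
  qed
qed

text \<open>Both summands lie below their positive sum, so heredity puts them into \<open>B\<close>
  once the sum is there.\<close>

lemma add_map_image_hereditary:
  fixes B :: "'a::unital_cstar_algebra set"
  assumes B: "cstar_subalgebra B" "hereditary B"
  shows "add_map ` add_dom B = add_map ` add_dom UNIV \<inter> B"
proof (intro equalityI subsetI)
  fix c assume "c \<in> add_map ` add_dom B"
  then obtain a b where ab: "(a, b) \<in> add_dom B" "c = a + b" by (auto simp: add_map_def)
  then have "c \<in> B" using B(1) by (auto simp: in_add_dom_iff cstar_subalgebra_def)
  moreover have "(a, b) \<in> add_dom UNIV" using ab(1) by (auto simp: in_add_dom_iff[OF B(1)] in_add_dom_UNIV_iff)
  ultimately show "c \<in> add_map ` add_dom UNIV \<inter> B" using ab(2) by (force simp: add_map_def)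
next
  fix c assume c: "c \<in> add_map ` add_dom UNIV \<inter> B"
  then obtain a b where ab: "(a, b) \<in> add_dom UNIV" "c = a + b" by (auto simp: add_map_def)
  then have n: "nonneg a" "nonneg b" by (simp_all add: in_add_dom_UNIV_iff)
  then have "cstar_le 0 c" "cstar_le 0 a" "cstar_le a c" "cstar_le 0 b" "cstar_le b c"
    using ab(2) by (simp_all add: cstar_le_def positive_in_iff[OF cstar_subalgebra_UNIV] nonneg_add)
  then have "a \<in> B" "b \<in> B" using B(2) c unfolding hereditary_def by blast+
  then have "(a, b) \<in> add_dom B" using ab(1) by (auto simp: in_add_dom_iff[OF B(1)] in_add_dom_UNIV_iff)
  then show "c \<in> add_map ` add_dom B" using ab(2) by (force simp: add_map_def)
qed

section \<open>Compactness and finite dimension\<close>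

text \<open>For a fixed \<open>a\<close> in an orthogonal family, the elements \<open>a + b\<close> of the image are at mutual distance \<open>\<ge> 1\<close>.\<close>

lemma orth_family_bounded_if_compact:
  assumes "compact (add_map ` add_dom (UNIV :: 'a::unital_cstar_algebra set))"
  shows "\<exists>N. \<forall>F :: 'a set. orth_family F \<longrightarrow> card F \<le> N"
proof -
  \<comment> \<open>Radius 1/2, because two sums in the same ball are then less than 1
    apart.\<close>
  obtain K where K: "finite K" "add_map ` add_dom (UNIV :: 'a set) \<subseteq> (\<Union>k\<in>K. ball k (1/2))"
    using assms unfolding compact_eq_totally_bounded by (meson half_gt_zero zero_less_one)
  have "card F \<le> Suc (card K)" if F: "orth_family F" for F :: "'a set"
  proof (cases "F = {}")
    case False
    then obtain a where a: "a \<in> F" by blast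
    have fin: "finite F" using F by (simp add: orth_family_def)
    have "\<exists>k\<in>K. a + b \<in> ball k (1/2)" if "b \<in> F - {a}" for b
    proof -
      have "(a, b) \<in> add_dom UNIV" using add_dom_of_orth_family[OF F a] that by blast
      then have "a + b \<in> add_map ` add_dom UNIV" by (force simp: add_map_def)
      then show ?thesis using K(2) by blast
    qed
    then obtain k where k: "\<And>b. b \<in> F - {a} \<Longrightarrow> k b \<in> K \<and> a + b \<in> ball (k b) (1/2)" by metis
    have "inj_on k (F - {a})"
    proof (rule inj_onI, rule ccontr)
      fix b c assume bc: "b \<in> F - {a}" "c \<in> F - {a}" "k b = k c" "b \<noteq> c"
      then have b: "nonneg b" "norm b = 1" "b * c = 0" using F by (auto simp: orth_family_def)
      have "dist (a + b) (a + c) < 1"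
        using k[OF bc(1)] k[OF bc(2)] bc(3) dist_triangle_half_r[of "k b" "a + b" 1 "a + c"] by simp
      then have "norm (b - c) < 1" by (simp add: dist_norm)
      \<comment> \<open>Here \<open>b * (b - c) = b * b\<close> keeps \<open>b\<close> and
        \<open>c\<close> at distance at least 1.\<close>
      moreover have "norm (b * b) \<le> norm b * norm (b - c)"
        using norm_mult_ineq[of b "b - c"] b(3) by (simp add: right_diff_distrib)
      ultimately show False using b(1,2) norm_square_self_adjoint[of b] by (simp add: nonneg_def)
    qed
    then have "card (F - {a}) \<le> card K" using K(1) k by (intro card_inj_on_le[of k]) auto
    then show ?thesis using a fin by simp
  qed simp
  then show ?thesis by blast
qed

text \<open>The induction hypothesis makes \<open>span S\<close> closed, so a new vector
  \<open>e\<close> has positive distance \<open>d\<close> from it. A coefficient \<open>t\<close> of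
  \<open>e\<close> in \<open>x\<close> then satisfies \<open>cmod t * d \<le> norm x\<close>; hence
  the coefficients are bounded and a subsequence of them converges.\<close>

lemma bounded_sequence_in_span:
  fixes S :: "'a::unital_cstar_algebra set" and x :: "nat \<Rightarrow> 'a"
  assumes "finite S" "\<And>n. x n \<in> cvs.span S" "bounded (range x)"
  shows "\<exists>l\<in>cvs.span S. \<exists>r. strict_mono r \<and> (x \<circ> r) \<longlonglongrightarrow> l"
  using assms
proof (induction S arbitrary: x)
  case empty
  then have "x = (\<lambda>n. 0)" by auto
  then have "(x \<circ> id) \<longlonglongrightarrow> 0" by (simp add: o_def)
  then show ?case using strict_mono_id by (metis cvs.span_zero)
next
  case (insert e S)
  have closed: "closed (cvs.span S)"
    unfolding closed_sequential_limits
  proof (intro allI impI)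
    fix y l assume y: "(\<forall>n. y n \<in> cvs.span S) \<and> y \<longlonglongrightarrow> l"
    then have "bounded (range y)" by (auto intro: convergent_imp_bounded)
    with y insert.IH obtain m r where m: "m \<in> cvs.span S" "strict_mono r" "(y \<circ> r) \<longlonglongrightarrow> m" by blast
    then have "m = l" using y LIMSEQ_subseq_LIMSEQ LIMSEQ_unique by blast
    then show "l \<in> cvs.span S" using m by simp
  qed
  show ?case
  proof (cases "e \<in> cvs.span S")
    case True
    then have "cvs.span (insert e S) = cvs.span S" by (rule cvs.span_redundant)
    then show ?thesis using insert by simp
  next
    case False
    define d where "d = infdist e (cvs.span S)"
    have d: "d > 0" unfolding d_def
      by (rule infdist_pos_not_in_closed[OF closed _ False]) (use cvs.span_zero in blast)
    have "\<exists>k. x n - k *\<^sub>C e \<in> cvs.span S" for n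
      using insert.prems(1)[of n] by (simp add: cvs.span_insert)
    then obtain t where t: "\<And>n. x n - t n *\<^sub>C e \<in> cvs.span S" by metis
    have tb: "cmod (t n) * d \<le> norm (x n)" for n
    proof (cases "t n = 0")
      case False
      define s where "s = x n - t n *\<^sub>C e"
      have "(- inverse (t n)) *\<^sub>C s \<in> cvs.span S" using t by (simp only: s_def cvs.span_scale)
      then have "d \<le> norm (e + inverse (t n) *\<^sub>C s)"
        unfolding d_def using infdist_le[of "(- inverse (t n)) *\<^sub>C s" "cvs.span S" e]
        by (simp add: dist_norm)
      moreover have "t n *\<^sub>C (e + inverse (t n) *\<^sub>C s) = x n"
        using False by (simp add: s_def scaleC_add_right scaleC_scaleC)
      ultimately show ?thesis by (metis norm_scaleC mult_left_mono norm_ge_zero)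
    qed simp
    obtain M where M: "\<And>n. norm (x n) \<le> M" using insert.prems(2) by (auto simp: bounded_iff)
    have tM: "cmod (t n) \<le> M / d" for n using tb[of n] M[of n] d by (simp add: field_simps)
    then have "bounded (range t)" by (auto simp: bounded_iff)
    then obtain k r where r: "strict_mono r" "(t \<circ> r) \<longlonglongrightarrow> k"
      using bounded_imp_convergent_subsequence by blast
    define s where "s n = x (r n) - t (r n) *\<^sub>C e" for n
    have "norm (s n) \<le> M + M / d * norm e" for n
    proof -
      have "norm (s n) \<le> norm (x (r n)) + norm (t (r n) *\<^sub>C e)" unfolding s_def by (rule norm_triangle_ineq4)
      also have "\<dots> \<le> M + M / d * norm e"
        unfolding norm_scaleC by (intro add_mono mult_right_mono M tM norm_ge_zero)
      finally show ?thesis .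
    qed
    then have "bounded (range s)" by (auto simp: bounded_iff)
    moreover have "s n \<in> cvs.span S" for n using t by (simp add: s_def)
    ultimately obtain l q where l: "l \<in> cvs.span S" "strict_mono q" "(s \<circ> q) \<longlonglongrightarrow> l"
      using insert.IH[of s] by blast
    have tq: "(\<lambda>n. t (r (q n))) \<longlonglongrightarrow> k" using LIMSEQ_subseq_LIMSEQ[OF r(2) l(2)] by (simp add: o_def)
    have "(\<lambda>n. t (r (q n)) *\<^sub>C e) \<longlonglongrightarrow> k *\<^sub>C e"
    proof -
      have "(\<lambda>n. cmod (t (r (q n)) - k) * norm e) \<longlonglongrightarrow> 0"
        using tendsto_mult_left_zero[OF tendsto_norm_zero[OF LIM_zero[OF tq]]] by simp
      then have "(\<lambda>n. norm (t (r (q n)) *\<^sub>C e - k *\<^sub>C e)) \<longlonglongrightarrow> 0"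
        by (simp flip: cvs.scale_left_diff_distrib add: norm_scaleC)
      then show ?thesis using LIM_zero_cancel tendsto_norm_zero_iff by blast
    qed
    from tendsto_add[OF l(3) this] have "(x \<circ> (r \<circ> q)) \<longlonglongrightarrow> l + k *\<^sub>C e"
      by (simp add: o_def s_def)
    moreover have "strict_mono (r \<circ> q)" using r(1) l(2) by (rule strict_mono_o)
    moreover have "l + k *\<^sub>C e \<in> cvs.span (insert e S)"
      using l(1) cvs.span_mono[of S "insert e S"]
      by (intro cvs.span_add cvs.span_scale) (auto intro: cvs.span_base)
    ultimately show ?thesis by blast
  qed
qed

lemma compact_cball_finite_dimensional:
  assumes "finite_dimensional TYPE('a::unital_cstar_algebra)"
  shows "compact (cball (0::'a) 1)"
proof -
  obtain S :: "'a set" where S: "finite S" "cvs.span S = UNIV"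
    using assms by (auto simp: finite_dimensional_def)
  show ?thesis
    unfolding compact_def
  proof (intro allI impI)
    fix x :: "nat \<Rightarrow> 'a" assume x: "\<forall>n. x n \<in> cball 0 1"
    then have "bounded (range x)" by (auto simp: bounded_iff)
    then obtain l r where l: "strict_mono r" "(x \<circ> r) \<longlonglongrightarrow> l"
      using bounded_sequence_in_span[OF S(1), of x] S(2) by auto
    have "l \<in> cball 0 1" by (rule closed_sequentially[OF closed_cball _ l(2)]) (use x in simp)
    then show "\<exists>l\<in>cball 0 1. \<exists>r. strict_mono r \<and> (x \<circ> r) \<longlonglongrightarrow> l" using l by blast
  qed
qed

text \<open>On the unit sphere positivity turns into closed conditions, which makes
  \<open>add_dom UNIV\<close> a closed subset of a product of balls.\<close>

lemma nonneg_unit_iff: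
  fixes a :: "'a::unital_cstar_algebra"
  assumes "norm a = 1" shows "nonneg a \<longleftrightarrow> star a = a \<and> norm (1 - a) \<le> 1"
  using nonneg_norm_le[of a 1] nonneg_if_norm_le[of a 1] assms by (auto simp: nonneg_def self_adjoint_def)

lemma compact_add_map_image:
  assumes "finite_dimensional TYPE('a::unital_cstar_algebra)"
  shows "compact (add_map ` add_dom (UNIV :: 'a set))"
proof -
  have star: "continuous_on UNIV (star :: 'a \<Rightarrow> 'a)"
    unfolding continuous_on by (auto intro!: tendsto_intros)
  have star_fst: "continuous_on UNIV (\<lambda>z :: 'a \<times> 'a. star (fst z))"
    and star_snd: "continuous_on UNIV (\<lambda>z :: 'a \<times> 'a. star (snd z))"
    by (intro continuous_on_compose2[OF star] continuous_intros; simp)+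
  have eq: "add_dom (UNIV :: 'a set) = (cball 0 1 \<times> cball 0 1) \<inter>
    ({z. star (fst z) = fst z} \<inter> {z. star (snd z) = snd z} \<inter> {z. norm (1 - fst z) \<le> 1} \<inter> {z. norm (1 - snd z) \<le> 1}
     \<inter> {z. norm (fst z) = 1} \<inter> {z. norm (snd z) = 1} \<inter> {z. fst z * snd z = 0})"
    by (auto simp: in_add_dom_UNIV_iff nonneg_unit_iff)
  have "compact (add_dom (UNIV :: 'a set))"
    unfolding eq
    by (intro compact_Int_closed compact_Times compact_cball_finite_dimensional[OF assms] closed_Int
        closed_Collect_eq closed_Collect_le continuous_intros star_fst star_snd)
  moreover have "continuous_on (add_dom (UNIV :: 'a set)) add_map"
    unfolding add_map_def case_prod_unfold by (intro continuous_intros)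
  ultimately show ?thesis by (rule compact_continuous_image[rotated])
qed

lemma compact_iff_finite_dimensional:
  "compact (add_map ` add_dom (UNIV :: 'a set)) \<longleftrightarrow> finite_dimensional TYPE('a::unital_cstar_algebra)"
  using orth_family_bounded_if_compact finite_dimensional_if_bounded compact_add_map_image by metis

section \<open>Algebras with a finite image\<close>

text \<open>Three orthogonal elements \<open>a\<close>, \<open>b\<close>, \<open>c\<close> would yield the infinitely many sums \<open>a + (b + t c)\<close>, \<open>0 \<le> t \<le> 1\<close>.\<close>

lemma orth_family_card_le_2:
  fixes F :: "'a::unital_cstar_algebra set"
  assumes fin: "finite (add_map ` add_dom (UNIV :: 'a set))" and F: "orth_family F"
  shows "card F \<le> 2"
proof (rule ccontr)
  assume "\<not> card F \<le> 2"
  then have "3 \<le> card F" by simp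
  then obtain G where "G \<subseteq> F" "card G = 3" by (meson obtain_subset_with_card_n)
  then obtain a b c where abc: "a \<in> F" "b \<in> F" "c \<in> F" "a \<noteq> b" "a \<noteq> c" "b \<noteq> c"
    by (auto simp: card_3_iff)
  have n: "nonneg a" "nonneg b" "nonneg c" "norm a = 1" "norm b = 1" "norm c = 1"
    "a * b = 0" "a * c = 0" "b * c = 0"
    using F abc by (auto simp: orth_family_def)
  have "a + (b + t *\<^sub>R c) \<in> add_map ` add_dom UNIV" if t: "t \<in> {0..1}" for t
  proof -
    have "norm (b + t *\<^sub>R c) = 1"
      using n t by (intro norm_add_orthogonal) (auto simp: nonneg_def self_adjoint_scaleR)
    moreover have "nonneg (b + t *\<^sub>R c)" using n t by (auto intro!: nonneg_add nonneg_scaleR)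
    ultimately have "(a, b + t *\<^sub>R c) \<in> add_dom UNIV"
      using n by (simp add: in_add_dom_UNIV_iff distrib_left)
    then show ?thesis by (force simp: add_map_def)
  qed
  then have "(\<lambda>t. a + (b + t *\<^sub>R c)) ` {0..1} \<subseteq> add_map ` add_dom UNIV" by blast
  moreover have "inj_on (\<lambda>t. a + (b + t *\<^sub>R c)) {0..1}"
    using n(6) by (auto simp: inj_on_def)
  ultimately have "finite {0..1::real}" using fin finite_imageD finite_subset by blast
  then show False by (simp add: infinite_Icc)
qed

text \<open>The spectrum contains 0 because \<open>a\<close> annihilates \<open>b\<close>, and 1
  because \<open>a\<close> is positive of norm 1. The bound leaves no third point, and
  \<open>t^2 - t\<close> vanishes at both.\<close>

lemma add_dom_idempotent:
  fixes a b :: "'a::unital_cstar_algebra"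
  assumes N: "\<And>F :: 'a set. orth_family F \<Longrightarrow> card F \<le> 2"
    and a: "nonneg a" "norm a = 1" and b: "a * b = 0" "b \<noteq> 0"
  shows "projection a"
proof -
  have sa: "self_adjoint a" using a by (simp add: nonneg_def)
  have "0 \<in> spectrum a"
    using alg_invertible_zero_divisor[of a b] b by (auto simp: spectrum_def)
  moreover have "1 \<in> spectrum a"
  proof -
    obtain t where t: "t \<in> spectrum a" "\<bar>t\<bar> = 1"
      using norm_rpeval_attained[OF sa, of "[:0, 1:]" 0 1] a(2) by auto
    then have "t \<ge> 0" using a(1) by (simp add: nonneg_def)
    then show ?thesis using t by simp
  qed
  ultimately have sub: "{0, 1} \<subseteq> spectrum a" by blast
  have "card {0, 1 :: real} = card (spectrum a)"
    using spectrum_card_le(2)[OF N sa] card_mono[OF spectrum_card_le(1)[OF N sa] sub] by simp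
  from card_subset_eq[OF spectrum_card_le(1)[OF N sa] sub this] have "spectrum a = {0, 1}" by simp
  then have "norm (rpeval [:0, -1, 1:] a) \<le> 0"
    by (intro norm_rpeval_le[OF sa]) auto
  then have "a * a = a" by (simp add: algebra_simps)
  then show ?thesis using sa by (simp add: projection_def self_adjoint_def)
qed

text \<open>The summands of a pair are projections; if their sum were not 1, the complement
  \<open>1 - a - b\<close> would be a third member of an orthogonal family.\<close>

lemma add_map_image_eq_1:
  assumes N: "\<And>F :: 'a::unital_cstar_algebra set. orth_family F \<Longrightarrow> card F \<le> 2"
    and "\<not> only_scalars TYPE('a)"
  shows "add_map ` add_dom (UNIV :: 'a set) = {1}"
proof -
  have "a + b = 1" if ab: "(a, b) \<in> add_dom (UNIV :: 'a set)" for a b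
  proof (rule ccontr)
    assume ne: "a + b \<noteq> 1"
    have n: "nonneg a" "nonneg b" "norm a = 1" "norm b = 1" "a * b = 0" "b * a = 0"
      using ab self_adjoint_orthogonal_sym by (auto simp: in_add_dom_UNIV_iff nonneg_def)
    then have "a \<noteq> 0" "b \<noteq> 0" by auto
    with n have p: "projection a" "projection b" using add_dom_idempotent[OF N] by blast+
    define c where "c = 1 - a - b"
    have c: "projection c" "c \<noteq> 0"
      using p n(5,6) ne by (auto simp: c_def projection_def star_diff star_add algebra_simps)
    have orth: "a * c = 0" "b * c = 0" "c * a = 0" "c * b = 0"
      using p n(5,6) by (auto simp: c_def projection_def algebra_simps)
    have "orth_family {a, b, c}"
      using n orth projection_nonneg[OF c(1)] projection_norm[OF c] by (auto simp: orth_family_def)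
    moreover have "a \<noteq> b" "a \<noteq> c" "b \<noteq> c"
      using p n(5) orth \<open>a \<noteq> 0\<close> \<open>b \<noteq> 0\<close> by (auto simp: projection_def)
    then have "card {a, b, c} = 3" by simp
    ultimately show False using N[of "{a, b, c}"] by simp
  qed
  then show ?thesis using add_dom_nonempty[OF assms(2)] by (force simp: add_map_def)
qed

text \<open>The explicit formulas below map the concrete algebra into the abstract one, opposite to
  the direction of \<open>star_isomorphism\<close>.\<close>

lemma star_isomorphism_inv:
  fixes g :: "'b::ab_group_add \<Rightarrow> 'a::unital_cstar_algebra"
  assumes "bij g" "\<And>x y. g (x + y) = g x + g y" "\<And>c x. g (sc c x) = c *\<^sub>C g x"
    "\<And>x y. g (tm x y) = g x * g y" "\<And>x. g (st x) = star (g x)"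
  shows "star_isomorphism sc tm st (inv g)"
proof -
  have g: "g (inv g x) = x" "inv g (g y) = y" for x y
    using assms(1) by (simp_all add: bij_is_surj surj_f_inv_f bij_is_inj)
  show ?thesis
    unfolding star_isomorphism_def using bij_imp_bij_inv[OF assms(1)] assms(2-5) g by metis
qed

lemma isomorphic_C2_if:
  fixes p q :: "'a::unital_cstar_algebra"
  assumes p: "projection p" "p \<noteq> 0" and q: "projection q" "q \<noteq> 0"
    and pq: "p * q = 0" "q * p = 0"
    and span: "\<And>x. \<exists>c d. x = c *\<^sub>C p + d *\<^sub>C q"
  shows "isomorphic_C2 TYPE('a)"
proof -
  define g :: "complex^2 \<Rightarrow> 'a" where "g v = (v $ 1) *\<^sub>C p + (v $ 2) *\<^sub>C q" for v
  have pp: "p * p = p" "star p = p" "q * q = q" "star q = q" using p q by (auto simp: projection_def)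
  have "bij g"
  proof (rule bijI)
    show "inj g"
    proof (rule injI)
      fix v w assume e: "g v = g w"
      have "p * g v = (v $ 1) *\<^sub>C p" "q * g v = (v $ 2) *\<^sub>C q" for v
        by (simp_all add: g_def distrib_left mult_scaleC_right pp pq)
      then have "(v $ 1) *\<^sub>C p = (w $ 1) *\<^sub>C p" "(v $ 2) *\<^sub>C q = (w $ 2) *\<^sub>C q" using e by metis+
      then show "v = w" using p(2) q(2) by (simp add: vec_eq_iff forall_2)
    qed
    show "surj g"
    proof (unfold surj_def, rule allI)
      fix x
      obtain c d where "x = c *\<^sub>C p + d *\<^sub>C q" using span by blast
      then have "x = g (\<chi> i. if i = 1 then c else d)" by (simp add: g_def)
      then show "\<exists>v. x = g v" by blast
    qed
  qed
  then have "star_isomorphism (*s) (*) (\<lambda>v. \<chi> i. cnj (v $ i)) (inv g)"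
    by (rule star_isomorphism_inv)
      (simp_all add: g_def pp pq scaleC_add_left scaleC_add_right scaleC_scaleC star_add star_scaleC
        distrib_left distrib_right mult_scaleC_left mult_scaleC_right mult.commute)
  then show ?thesis unfolding isomorphic_C2_def by blast
qed

text \<open>\<open>p\<close>, \<open>star u\<close>, \<open>u\<close>, \<open>q\<close> are the
  matrix units with indices 11, 12, 21, 22, and the four corners cut out by \<open>p\<close> and
  \<open>q\<close> recover the entries.\<close>

lemma isomorphic_M2_if:
  fixes p q u :: "'a::unital_cstar_algebra"
  assumes p: "projection p" "p \<noteq> 0" and q: "projection q" "q \<noteq> 0"
    and pq: "p * q = 0" "q * p = 0"
    and u: "star u * u = p" "u * star u = q" "q * u = u" "u * p = u"
    and span: "\<And>x. \<exists>c d e f. x = c *\<^sub>C p + d *\<^sub>C star u + e *\<^sub>C u + f *\<^sub>C q"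
  shows "isomorphic_M2 TYPE('a)"
proof -
  define g :: "complex^2^2 \<Rightarrow> 'a"
    where "g M = (M $ 1 $ 1) *\<^sub>C p + (M $ 1 $ 2) *\<^sub>C star u + (M $ 2 $ 1) *\<^sub>C u + (M $ 2 $ 2) *\<^sub>C q" for M
  have pp: "p * p = p" "star p = p" "q * q = q" "star q = q" using p q by (auto simp: projection_def)
  have us: "p * star u = star u" "star u * q = star u"
    using u(3,4) pp by (metis star_mult)+
  have zero: "p * u = 0" "u * q = 0" "u * u = 0" "star u * p = 0" "q * star u = 0" "star u * star u = 0"
  proof -
    show pu: "p * u = 0" using u(3) pq(1) by (metis mult.assoc mult_zero_left)
    show uq: "u * q = 0" using u(4) pq(1) by (metis mult.assoc mult_zero_right)
    show "u * u = 0" using u(4) pu by (metis mult.assoc mult_zero_right)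
    show "star u * p = 0" using us(2) pq(2) by (metis mult.assoc mult_zero_right)
    show "q * star u = 0" using us(1) pq(2) by (metis mult.assoc mult_zero_left)
    show "star u * star u = 0" using us(1) \<open>star u * p = 0\<close> by (metis mult.assoc mult_zero_left)
  qed
  note units = pp pq u us zero star_star
  have "u \<noteq> 0" "star u \<noteq> 0" using u(1) p(2) by auto
  have "bij g"
  proof (rule bijI)
    show "inj g"
    proof (rule injI)
      fix M N assume e: "g M = g N"
      have "p * g M * p = (M $ 1 $ 1) *\<^sub>C p" "p * g M * q = (M $ 1 $ 2) *\<^sub>C star u"
        "q * g M * p = (M $ 2 $ 1) *\<^sub>C u" "q * g M * q = (M $ 2 $ 2) *\<^sub>C q" for M
        by (simp_all add: g_def distrib_left distrib_right mult_scaleC_left mult_scaleC_right units)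
      then have "(M $ 1 $ 1) *\<^sub>C p = (N $ 1 $ 1) *\<^sub>C p" "(M $ 1 $ 2) *\<^sub>C star u = (N $ 1 $ 2) *\<^sub>C star u"
        "(M $ 2 $ 1) *\<^sub>C u = (N $ 2 $ 1) *\<^sub>C u" "(M $ 2 $ 2) *\<^sub>C q = (N $ 2 $ 2) *\<^sub>C q"
        using e by metis+
      then show "M = N" using p(2) q(2) \<open>u \<noteq> 0\<close> \<open>star u \<noteq> 0\<close> by (simp add: vec_eq_iff forall_2)
    qed
    show "surj g"
    proof (unfold surj_def, rule allI)
      fix x
      obtain c d e f where "x = c *\<^sub>C p + d *\<^sub>C star u + e *\<^sub>C u + f *\<^sub>C q" using span by blast
      then have "x = g (\<chi> i j. if i = 1 then if j = 1 then c else d else if j = 1 then e else f)"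
        by (simp add: g_def)
      then show "\<exists>M. x = g M" by blast
    qed
  qed
  then have "star_isomorphism (\<lambda>c. map_matrix ((*) c)) (**) (\<lambda>M. transpose (map_matrix cnj M)) (inv g)"
  proof (rule star_isomorphism_inv)
    fix M N :: "complex^2^2" and c
    show "g (M + N) = g M + g N" by (simp add: g_def scaleC_add_left)
    show "g (map_matrix ((*) c) M) = c *\<^sub>C g M"
      by (simp add: g_def map_matrix_def scaleC_add_right scaleC_scaleC)
    show "g (transpose (map_matrix cnj M)) = star (g M)"
      by (simp add: g_def map_matrix_def transpose_def star_add star_scaleC units)
    show "g (M ** N) = g M * g N"
      by (simp add: g_def matrix_matrix_mult_def sum_2 distrib_left distrib_right mult_scaleC_left
          mult_scaleC_right scaleC_scaleC scaleC_add_left scaleC_add_right units add_ac mult.commute)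
  qed
  then show ?thesis unfolding isomorphic_M2_def by blast
qed

text \<open>There are exactly two minimal projections \<open>p\<close> and \<open>q\<close>, with
  sum 1. If \<open>qAp\<close> is zero, so is \<open>pAq\<close> by taking adjoints, and only the
  multiples of \<open>p\<close> and \<open>q\<close> remain. Otherwise a nonzero element of
  \<open>qAp\<close> rescales to a partial isometry from \<open>p\<close> to \<open>q\<close>, which
  completes a system of matrix units.\<close>

lemma isomorphic_C2_or_M2:
  assumes N: "\<And>F :: 'a::unital_cstar_algebra set. orth_family F \<Longrightarrow> card F \<le> 2"
    and nonscalar: "\<not> only_scalars TYPE('a)"
  shows "isomorphic_C2 TYPE('a) \<or> isomorphic_M2 TYPE('a)"
proof -
  obtain F :: "'a set" where F: "orth_family F" "\<And>p. p \<in> F \<Longrightarrow> minimal_projection p" "\<Sum>F = 1"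
    using minimal_projection_decomposition[OF N] by blast
  have corner: "\<exists>c. p * x * p = c *\<^sub>C p" if "p \<in> F" for p x
    using minimal_projection_corner[OF spectrum_card_le(1)[OF N] F(2)[OF that]] by blast
  have "finite F" using F(1) by (simp add: orth_family_def)
  have "card F \<noteq> 0" using F(3) \<open>finite F\<close> by auto
  moreover have "card F \<noteq> 1"
  proof
    assume "card F = 1"
    then obtain p where "F = {p}" by (rule card_1_singletonE)
    then have "1 \<in> F" using F(3) by simp
    \<comment> \<open>The corner of 1 is the whole algebra, so it would consist of scalars.\<close>
    from corner[OF this] show False using nonscalar by (simp add: only_scalars_def)
  qed
  ultimately have "card F = 2" using N[OF F(1)] by linarith
  then obtain p q where pq: "F = {p, q}" "p \<noteq> q" by (meson card_2_iff)
  have p: "projection p" "p \<noteq> 0" "star p = p" "p * p = p" and q: "projection q" "q \<noteq> 0" "star q = q" "q * q = q"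
    using F(2) pq(1) by (auto simp: minimal_projection_def projection_def)
  have orth: "p * q = 0" "q * p = 0" using F(1) pq by (auto simp: orth_family_def)
  have sum: "p + q = 1" using F(3) pq by simp
  have cp: "\<exists>c. p * x * p = c *\<^sub>C p" and cq: "\<exists>c. q * x * q = c *\<^sub>C q" for x
    using corner pq(1) by blast+
  have decomp: "x = p * x * p + p * x * q + q * x * p + q * x * q" for x
  proof -
    have "x = (p + q) * x * (p + q)" by (simp add: sum)
    then show ?thesis by (simp add: algebra_simps)
  qed
  show ?thesis
  proof (cases "\<forall>x. q * x * p = 0")
    case True
    have "p * x * q = 0" for x
      using True[rule_format, of "star x"] p(3) q(3) by (metis mult.assoc star_0 star_mult star_star)
    then have "\<exists>c d. x = c *\<^sub>C p + d *\<^sub>C q" for x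
      using decomp[of x] True cp[of x] cq[of x] by (metis add.right_neutral)
    then show ?thesis using isomorphic_C2_if[OF p(1,2) q(1,2) orth] by blast
  next
    case False
    then obtain x0 where "q * x0 * p \<noteq> 0" by blast
    define v where "v = q * x0 * p"
    have v: "v \<noteq> 0" "q * v = v" "v * p = v"
      using \<open>q * x0 * p \<noteq> 0\<close> p(4) q(4) by (simp_all add: v_def mult.assoc) (simp add: mult.assoc[symmetric])
    then have vs: "p * star v = star v" using p(3) by (metis star_mult)
    have "star v * v = p * (star v * v) * p" using v(3) vs by (metis mult.assoc)
    then obtain l where l: "star v * v = l *\<^sub>C p" using cp by metis
    have "l \<noteq> 0"
      using l v(1) cstar_identity[of v] by auto
    have "star (star v * v) = star v * v" by (simp add: star_mult star_star)
    then have "cnj l *\<^sub>C p = l *\<^sub>C p" unfolding l star_scaleC p(3) .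
    then have "cnj l = l" using p(2) by simp
    then obtain r where r: "l = complex_of_real r" by (metis Reals_cases Reals_cnj_iff)
    \<comment> \<open>Otherwise \<open>star v * v = r p\<close> would be nonpositive and therefore
      zero. Positivity of \<open>r\<close> permits the rescaling of \<open>v\<close> by
      \<open>1 / sqrt r\<close>.\<close>
    have "r > 0"
    proof (rule ccontr)
      assume "\<not> r > 0"
      then have "nonneg ((- r) *\<^sub>R p)" by (intro nonneg_scaleR projection_nonneg p(1)) simp
      then have "star v * v = 0"
        using l r by (intro star_mult_nonpos_eq_0) (simp add: scaleR_scaleC)
      then show False using l \<open>l \<noteq> 0\<close> p(2) by simp
    qed
    define u where "u = (1 / sqrt r) *\<^sub>R v"
    have "u \<noteq> 0" using v(1) \<open>r > 0\<close> by (simp add: u_def)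
    have qu: "q * u = u" "u * p = u" using v by (simp_all add: u_def)
    have uu: "star u * u = p"
      using l r \<open>r > 0\<close> by (simp add: u_def star_scaleR scaleC_of_real)
    have uq: "star u * q = star u" using qu q(3) by (metis star_mult)
    have "u * star u = q * (u * star u) * q" using qu uq by (metis mult.assoc)
    then obtain m where m: "u * star u = m *\<^sub>C q" using cq by metis
    have "(u * star u) * u = u" using uu qu by (simp add: mult.assoc)
    then have "m *\<^sub>C u = 1 *\<^sub>C u" using m qu by (simp add: mult_scaleC_left)
    then have "m = 1" using \<open>u \<noteq> 0\<close> cvs.scale_right_imp_eq by blast
    then have uus: "u * star u = q" using m by simp
    have qxp: "\<exists>c. q * x * p = c *\<^sub>C u" for x
    proof -
      have "p * (star u * x) * p = star u * x * p"
        using qu(2) p(3) by (metis mult.assoc star_mult)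
      then obtain c where "star u * x * p = c *\<^sub>C p" using cp by metis
      then have "u * (star u * x * p) = c *\<^sub>C u" using qu(2) by (simp add: mult_scaleC_right)
      then show ?thesis using uus by (metis mult.assoc)
    qed
    have pxq: "\<exists>c. p * x * q = c *\<^sub>C star u" for x
    proof -
      obtain c where c: "q * star x * p = c *\<^sub>C u" using qxp by blast
      have "p * x * q = star (q * star x * p)" using p(3) q(3) by (simp add: star_mult star_star mult.assoc)
      then show ?thesis unfolding c by (auto simp: star_scaleC)
    qed
    have "\<exists>c d e f. x = c *\<^sub>C p + d *\<^sub>C star u + e *\<^sub>C u + f *\<^sub>C q" for x
      using decomp[of x] cp[of x] cq[of x] pxq[of x] qxp[of x] by metis
    then show ?thesis using isomorphic_M2_if[OF p(1,2) q(1,2) orth uu uus qu] by blast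
  qed
qed

theorem proposition3:
  shows
    "add_map ` add_dom (UNIV :: 'a::unital_cstar_algebra set) \<subseteq> sphere 0 1 \<and>
     (\<not> only_scalars TYPE('a) \<longrightarrow>
        unit_dist TYPE('a) \<in> {0, 1} \<and>
        (unit_dist TYPE('a) = 1 \<longleftrightarrow> \<not> (\<exists>a::'a. nontrivial_projection a))) \<and>
     (closed (add_map ` add_dom (UNIV :: 'a set)) \<longrightarrow>
        (\<forall>B :: 'a set. cstar_subalgebra B \<and> hereditary B \<longrightarrow>
           closedin (top_of_set B) (add_map ` add_dom B))) \<and>
     (\<not> only_scalars TYPE('a) \<and> finite (add_map ` add_dom (UNIV :: 'a set)) \<longrightarrow>
        add_map ` add_dom (UNIV :: 'a set) = {1} \<and>
        (isomorphic_C2 TYPE('a) \<or> isomorphic_M2 TYPE('a))) \<and>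
     (compact (add_map ` add_dom (UNIV :: 'a set)) \<longleftrightarrow> finite_dimensional TYPE('a))"
proof (intro conjI impI allI)
  show "add_map ` add_dom (UNIV :: 'a set) \<subseteq> sphere 0 1"
    using norm_add_dom by (auto simp: add_map_def)
next
  assume "\<not> only_scalars TYPE('a)"
  from unit_dist_cases[OF this] show "unit_dist TYPE('a) \<in> {0, 1}"
    and "unit_dist TYPE('a) = 1 \<longleftrightarrow> \<not> (\<exists>a::'a. nontrivial_projection a)" by auto
next
  fix B :: "'a set"
  assume "closed (add_map ` add_dom (UNIV :: 'a set))" "cstar_subalgebra B \<and> hereditary B"
  then show "closedin (top_of_set B) (add_map ` add_dom B)"
    using add_map_image_hereditary[of B] by (auto simp: closedin_closed)
next
  assume "\<not> only_scalars TYPE('a) \<and> finite (add_map ` add_dom (UNIV :: 'a set))"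
  then show "add_map ` add_dom (UNIV :: 'a set) = {1}"
    and "isomorphic_C2 TYPE('a) \<or> isomorphic_M2 TYPE('a)"
    using orth_family_card_le_2 add_map_image_eq_1 isomorphic_C2_or_M2 by blast+
next
  show "compact (add_map ` add_dom (UNIV :: 'a set)) \<longleftrightarrow> finite_dimensional TYPE('a)"
    by (rule compact_iff_finite_dimensional)
qed

end
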